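(* Let $X$ be a $1$-skeletal simplicial set with finitely many non-degenerate simplices. A simplicial distribution $p:\Delta[0]\ast X\to D(N\mathbb{Z}_2)$ is strongly contextual if and only if there exists a circle $C\subset X$ such that $p|_{C}=\delta^{\varphi}$ for some simplicial set map $\varphi:C\to N\mathbb{Z}_2$ that is not null-homotopic.
   Context: For a set $S$, $D(S)$ is the set of finitely supported functions $p:S\to\mathbb{R}_{\ge 0}$ with $\sum_{s}p(s)=1$; for $f:S\to S'$, $D(f)(p)(s')=\sum_{s\in f^{-1}(s')}p(s)$. For a simplicial set $Y$, $D(Y)$ is the simplicial set with $D(Y)_n=D(Y_n)$ and structure maps $D(d_i),D(s_j)$. A simplicial distribution on $(Z,Y)$ is a simplicial set map $p:Z\to D(Y)$. For a simplicial set map $\varphi:Z\to Y$, $\delta^\varphi:Z\to D(Y)$ is the simplicial distribution sending a simplex $z$ to the delta distribution at $\varphi(z)$. The support $\mathrm{supp}(p)$ is the set of simplicial set maps $\varphi:Z\to Y$ with $p_n(z)(\varphi_n(z))\neq 0$ for all $n$ and $z\in Z_n$; $p$ is strongly contextual if $\mathrm{supp}(p)=\emptyset$. $N\mathbb{Z}_2$ is the nerve of the group $\mathbb{Z}_2$. A map is null-homotopic if it is simplicially homotopic to a constant map. The cone $\Delta[0]\ast X$ has $n$-simplices $\{c_n\}\sqcup X_n\sqcup\bigsqcup_{k+1+l=n}\{c_k\}\times X_l$, where $c_n$ is the $n$-fold degeneracy of the cone point $c_0$; on $(c_k,\sigma)$: $d_i(c_k,\sigma)=(c_{k-1},\sigma)$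 for $i\le k$ (with $(c_{-1},\sigma)=\sigma$) and $d_i(c_k,\sigma)=(c_k,d_{i-1-k}\sigma)$ for $i>k$ (read as $c_k$ when $\sigma$ has dimension $0$); $s_j(c_k,\sigma)=(c_{k+1},\sigma)$ for $j\le k$ and $(c_k,s_{j-1-k}\sigma)$ for $j>k$; on the summands $\{c_n\}$ and $X_n$ the structure maps are those of $\Delta[0]$ and $X$. In particular $X\subset\Delta[0]\ast X$. A circle is a $1$-skeletal simplicial set $C$ with pairwise distinct non-degenerate $1$-simplices $\sigma_1,\dots,\sigma_n$ ($n\ge 1$) and exactly $n$ distinct $0$-simplices $v_1,\dots,v_n$ such that for some $i_k\in\{0,1\}$ and $i'_k=1-i_k$ one has $d_{i_k}(\sigma_k)=v_k$ and $d_{i'_k}(\sigma_k)=v_{k+1}$ for all $k$, with $v_{n+1}=v_1$. *)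

theory Defs
  imports "HOL-Probability.Probability" "HOL-Library.Z2"
begin

text \<open>
  A simplicial set is a record of carriers and structure maps indexed by the dimension of
  their argument: \<open>face X n i\<close> is \<open>d\<^sub>i : X\<^sub>n \<rightarrow> X\<^sub>n\<^sub>-\<^sub>1\<close> (for \<open>n \<ge> 1\<close>) and \<open>degen X n j\<close> is
  \<open>s\<^sub>j : X\<^sub>n \<rightarrow> X\<^sub>n\<^sub>+\<^sub>1\<close>.  Structure maps and simplicial maps are meaningful on the carriers
  only, and the same element may represent simplices of different dimensions.
\<close>

record 'a sset =
  simplices :: "nat \<Rightarrow> 'a set"
  face :: "nat \<Rightarrow> nat \<Rightarrow> 'a \<Rightarrow> 'a"
  degen :: "nat \<Rightarrow> nat \<Rightarrow> 'a \<Rightarrow> 'a"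

locale simplicial_set =
  fixes X :: "'a sset"
  assumes face_closed:
      "\<lbrakk>x \<in> simplices X (Suc n); i \<le> Suc n\<rbrakk> \<Longrightarrow> face X (Suc n) i x \<in> simplices X n"
    and degen_closed:
      "\<lbrakk>x \<in> simplices X n; j \<le> n\<rbrakk> \<Longrightarrow> degen X n j x \<in> simplices X (Suc n)"
    and face_face:
      "\<lbrakk>x \<in> simplices X (Suc (Suc n)); i < j; j \<le> Suc (Suc n)\<rbrakk> \<Longrightarrow>
        face X (Suc n) i (face X (Suc (Suc n)) j x) =
        face X (Suc n) (j - 1) (face X (Suc (Suc n)) i x)"
    and degen_degen:
      "\<lbrakk>x \<in> simplices X n; i \<le> j; j \<le> n\<rbrakk> \<Longrightarrow>
        degen X (Suc n) i (degen X n j x) = degen X (Suc n) (Suc j) (degen X n i x)"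
    and face_degen_less:
      "\<lbrakk>x \<in> simplices X n; i < j; j \<le> n\<rbrakk> \<Longrightarrow>
        face X (Suc n) i (degen X n j x) = degen X (n - 1) (j - 1) (face X n i x)"
    and face_degen_id:
      "\<lbrakk>x \<in> simplices X n; i = j \<or> i = Suc j; j \<le> n\<rbrakk> \<Longrightarrow>
        face X (Suc n) i (degen X n j x) = x"
    and face_degen_greater:
      "\<lbrakk>x \<in> simplices X n; Suc j < i; i \<le> Suc n\<rbrakk> \<Longrightarrow>
        face X (Suc n) i (degen X n j x) = degen X (n - 1) j (face X n (i - 1) x)"

definition simplicial_map :: "'a sset \<Rightarrow> 'b sset \<Rightarrow> (nat \<Rightarrow> 'a \<Rightarrow> 'b) \<Rightarrow> bool" where
  "simplicial_map X Y f \<longleftrightarrow>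
     (\<forall>n. \<forall>x \<in> simplices X n. f n x \<in> simplices Y n) \<and>
     (\<forall>n. \<forall>x \<in> simplices X (Suc n). \<forall>i \<le> Suc n.
        f n (face X (Suc n) i x) = face Y (Suc n) i (f (Suc n) x)) \<and>
     (\<forall>n. \<forall>x \<in> simplices X n. \<forall>j \<le> n.
        f (Suc n) (degen X n j x) = degen Y n j (f n x))"

definition sub_sset :: "'a sset \<Rightarrow> 'a sset \<Rightarrow> bool" where
  "sub_sset C X \<longleftrightarrow>
     simplicial_set C \<and>
     (\<forall>n. simplices C n \<subseteq> simplices X n) \<and>
     (\<forall>n. \<forall>x \<in> simplices C (Suc n). \<forall>i \<le> Suc n. face C (Suc n) i x = face X (Suc n) i x) \<and>
     (\<forall>n. \<forall>x \<in> simplices C n. \<forall>j \<le> n. degen C n j x = degen X n j x)"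

definition degenerate :: "'a sset \<Rightarrow> nat \<Rightarrow> 'a \<Rightarrow> bool" where
  "degenerate X n x \<longleftrightarrow>
     (\<exists>m j y. n = Suc m \<and> j \<le> m \<and> y \<in> simplices X m \<and> x = degen X m j y)"

definition nondegenerate :: "'a sset \<Rightarrow> nat \<Rightarrow> 'a set" where
  "nondegenerate X n = {x \<in> simplices X n. \<not> degenerate X n x}"

definition skeletal :: "nat \<Rightarrow> 'a sset \<Rightarrow> bool" where
  "skeletal k X \<longleftrightarrow> (\<forall>n > k. nondegenerate X n = {})"

definition finitely_many_nondegenerate :: "'a sset \<Rightarrow> bool" where
  "finitely_many_nondegenerate X \<longleftrightarrow> finite (SIGMA n : UNIV. nondegenerate X n)"


text \<open>
  A finitely supported distribution on a set \<open>S\<close> is a probability mass function with finite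
  support contained in \<open>S\<close>; the map \<open>D(f)\<close> is \<^const>\<open>map_pmf\<close> and the delta distribution is
  \<^const>\<open>return_pmf\<close>.  The next two lemmas compare this with the elementary description.
\<close>

definition dists :: "'a set \<Rightarrow> 'a pmf set" where
  "dists S = {p. finite (set_pmf p) \<and> set_pmf p \<subseteq> S}"

lemma pmf_image_dists:
  "pmf ` dists S =
     {f. (\<forall>x. 0 \<le> f x) \<and> finite {x. f x \<noteq> 0} \<and> {x. f x \<noteq> 0} \<subseteq> S \<and> (\<Sum>x | f x \<noteq> 0. f x) = 1}"
  (is "_ = ?R")
proof (intro equalityI subsetI)
  fix f assume "f \<in> pmf ` dists S"
  then obtain p where p: "p \<in> dists S" "f = pmf p" by auto
  have eq: "{x. f x \<noteq> 0} = set_pmf p"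
    by (simp add: p set_pmf_eq)
  have "(\<Sum>x | f x \<noteq> 0. f x) = 1"
    unfolding eq using p by (simp add: dists_def sum_pmf_eq_1)
  then show "f \<in> ?R" using p eq by (auto simp: dists_def)
next
  fix f assume f: "f \<in> ?R"
  have "(\<integral>\<^sup>+ x. ennreal (f x) \<partial>count_space UNIV) = (\<Sum>x | f x \<noteq> 0. ennreal (f x))"
    using f by (subst nn_integral_count_space'[where A = "{x. f x \<noteq> 0}"]) auto
  also have "\<dots> = 1"
    using f by (subst sum_ennreal) auto
  finally have e: "pmf (embed_pmf f) = f"
    using f by (intro ext pmf_embed_pmf) auto
  then have "set_pmf (embed_pmf f) = {x. f x \<noteq> 0}"
    by (simp add: set_pmf_eq)
  then have "embed_pmf f \<in> dists S"
    using f by (simp add: dists_def)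
  with e show "f \<in> pmf ` dists S" by (metis imageI)
qed

lemma pmf_map_dists:
  assumes "p \<in> dists S"
  shows "pmf (map_pmf f p) y = (\<Sum>x \<in> {x \<in> set_pmf p. f x = y}. pmf p x)"
proof -
  have "pmf (map_pmf f p) y = measure p (f -` {y})"
    by (simp add: pmf_map)
  also have "\<dots> = measure p (f -` {y} \<inter> set_pmf p)"
    by (simp add: measure_Int_set_pmf)
  also have "f -` {y} \<inter> set_pmf p = {x \<in> set_pmf p. f x = y}"
    by auto
  also have "measure p \<dots> = (\<Sum>x \<in> {x \<in> set_pmf p. f x = y}. pmf p x)"
    using assms by (intro measure_measure_pmf_finite) (auto simp: dists_def)
  finally show ?thesis .
qed

definition dist_sset :: "'a sset \<Rightarrow> 'a pmf sset" where
  "dist_sset Y =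
     \<lparr>simplices = (\<lambda>n. dists (simplices Y n)),
      face = (\<lambda>n i. map_pmf (face Y n i)),
      degen = (\<lambda>n j. map_pmf (degen Y n j))\<rparr>"

abbreviation simplicial_distribution ::
    "'a sset \<Rightarrow> 'b sset \<Rightarrow> (nat \<Rightarrow> 'a \<Rightarrow> 'b pmf) \<Rightarrow> bool" where
  "simplicial_distribution Z Y p \<equiv> simplicial_map Z (dist_sset Y) p"

definition delta :: "(nat \<Rightarrow> 'a \<Rightarrow> 'b) \<Rightarrow> nat \<Rightarrow> 'a \<Rightarrow> 'b pmf" where
  "delta \<phi> n z = return_pmf (\<phi> n z)"

definition support_dist ::
    "'a sset \<Rightarrow> 'b sset \<Rightarrow> (nat \<Rightarrow> 'a \<Rightarrow> 'b pmf) \<Rightarrow> (nat \<Rightarrow> 'a \<Rightarrow> 'b) set" where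
  "support_dist Z Y p =
     {\<phi>. simplicial_map Z Y \<phi> \<and> (\<forall>n. \<forall>z \<in> simplices Z n. pmf (p n z) (\<phi> n z) \<noteq> 0)}"

definition strongly_contextual ::
    "'a sset \<Rightarrow> 'b sset \<Rightarrow> (nat \<Rightarrow> 'a \<Rightarrow> 'b pmf) \<Rightarrow> bool" where
  "strongly_contextual Z Y p \<longleftrightarrow> support_dist Z Y p = {}"


text \<open>
  The nerve of an additively written monoid.  An \<open>n\<close>-simplex is a list of length \<open>n\<close>; entries
  are numbered from 0 here.  For \<open>\<int>\<^sub>2\<close> the additive group of the field \<^typ>\<open>bit\<close> is used.
\<close>

definition nerve :: "'g::monoid_add list sset" where
  "nerve =
     \<lparr>simplices = (\<lambda>n. {gs. length gs = n}),
      face = (\<lambda>n i gs. if i = 0 then tl gs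
                       else if i = n then butlast gs
                       else take (i - 1) gs @ [gs ! (i - 1) + gs ! i] @ drop (i + 1) gs),
      degen = (\<lambda>n j gs. take j gs @ [0] @ drop j gs)\<rparr>"

definition N_Z2 :: "bit list sset" where
  "N_Z2 = nerve"


text \<open>An \<open>m\<close>-simplex of \<open>\<Delta>[n]\<close> is a monotone map \<open>[m] \<rightarrow> [n]\<close>, given by its list of values.\<close>

definition std_simplex :: "nat \<Rightarrow> nat list sset" where
  "std_simplex n =
     \<lparr>simplices = (\<lambda>m. {xs. length xs = Suc m \<and> sorted xs \<and> set xs \<subseteq> {..n}}),
      face = (\<lambda>m i xs. take i xs @ drop (Suc i) xs),
      degen = (\<lambda>m j xs. take (Suc j) xs @ drop j xs)\<rparr>"

definition prod_sset :: "'a sset \<Rightarrow> 'b sset \<Rightarrow> ('a \<times> 'b) sset" where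
  "prod_sset X Y =
     \<lparr>simplices = (\<lambda>n. simplices X n \<times> simplices Y n),
      face = (\<lambda>n i. map_prod (face X n i) (face Y n i)),
      degen = (\<lambda>n j. map_prod (degen X n j) (degen Y n j))\<rparr>"

definition simplicially_homotopic ::
    "'a sset \<Rightarrow> 'b sset \<Rightarrow> (nat \<Rightarrow> 'a \<Rightarrow> 'b) \<Rightarrow> (nat \<Rightarrow> 'a \<Rightarrow> 'b) \<Rightarrow> bool" where
  "simplicially_homotopic X Y f g \<longleftrightarrow>
     (\<exists>H. simplicial_map (prod_sset X (std_simplex 1)) Y H \<and>
          (\<forall>n. \<forall>x \<in> simplices X n. H n (x, replicate (Suc n) 0) = f n x) \<and>
          (\<forall>n. \<forall>x \<in> simplices X n. H n (x, replicate (Suc n) 1) = g n x))"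

primrec vertex_degen :: "'a sset \<Rightarrow> 'a \<Rightarrow> nat \<Rightarrow> 'a" where
  "vertex_degen Y y 0 = y"
| "vertex_degen Y y (Suc n) = degen Y n 0 (vertex_degen Y y n)"

definition const_map :: "'b sset \<Rightarrow> 'b \<Rightarrow> nat \<Rightarrow> 'a \<Rightarrow> 'b" where
  "const_map Y y n x = vertex_degen Y y n"

definition null_homotopic :: "'a sset \<Rightarrow> 'b sset \<Rightarrow> (nat \<Rightarrow> 'a \<Rightarrow> 'b) \<Rightarrow> bool" where
  "null_homotopic X Y f \<longleftrightarrow>
     (\<exists>y \<in> simplices Y 0. simplicially_homotopic X Y f (const_map Y y))"


text \<open>
  The cone \<open>\<Delta>[0] * X\<close>: \<open>Apex n\<close> is the \<open>n\<close>-fold degeneracy \<open>c\<^sub>n\<close> of the cone point,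
  \<open>Base \<sigma>\<close> is a simplex of \<open>X\<close>, and \<open>Mixed k \<sigma>\<close> is the pair \<open>(c\<^sub>k, \<sigma>)\<close>.  In an
  \<open>n\<close>-simplex \<open>Mixed k \<sigma>\<close> the simplex \<open>\<sigma>\<close> has dimension \<open>n - 1 - k\<close>.
\<close>

datatype 'a cone_simplex = Apex nat | Base 'a | Mixed nat 'a

fun cone_face :: "'a sset \<Rightarrow> nat \<Rightarrow> nat \<Rightarrow> 'a cone_simplex \<Rightarrow> 'a cone_simplex" where
  "cone_face X n i (Apex m) = Apex (m - 1)"
| "cone_face X n i (Base \<sigma>) = Base (face X n i \<sigma>)"
| "cone_face X n i (Mixed k \<sigma>) =
     (if i \<le> k then (if k = 0 then Base \<sigma> else Mixed (k - 1) \<sigma>)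
      else if n = Suc k then Apex k
      else Mixed k (face X (n - 1 - k) (i - 1 - k) \<sigma>))"

fun cone_degen :: "'a sset \<Rightarrow> nat \<Rightarrow> nat \<Rightarrow> 'a cone_simplex \<Rightarrow> 'a cone_simplex" where
  "cone_degen X n j (Apex m) = Apex (Suc m)"
| "cone_degen X n j (Base \<sigma>) = Base (degen X n j \<sigma>)"
| "cone_degen X n j (Mixed k \<sigma>) =
     (if j \<le> k then Mixed (Suc k) \<sigma>
      else Mixed k (degen X (n - 1 - k) (j - 1 - k) \<sigma>))"

definition cone_sset :: "'a sset \<Rightarrow> 'a cone_simplex sset" where
  "cone_sset X =
     \<lparr>simplices = (\<lambda>n. {Apex n} \<union> Base ` simplices X n \<union>
                        {Mixed k \<sigma> | k l \<sigma>. k + 1 + l = n \<and> \<sigma> \<in> simplices X l}),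
      face = cone_face X,
      degen = cone_degen X\<rparr>"


text \<open>
  The edges \<open>\<sigma>\<^sub>0, \<dots>, \<sigma>\<^sub>m\<^sub>-\<^sub>1\<close> are all the non-degenerate edges and \<open>v\<^sub>0, \<dots>, v\<^sub>m\<^sub>-\<^sub>1\<close> all the
  vertices, numbered from 0; \<open>v\<^sub>m\<close> is \<open>v\<^sub>0\<close>.
\<close>

definition circle :: "'a sset \<Rightarrow> bool" where
  "circle C \<longleftrightarrow>
     simplicial_set C \<and> skeletal 1 C \<and>
     (\<exists>m \<sigma> v (\<iota> :: nat \<Rightarrow> nat).
        m \<ge> 1 \<and>
        inj_on \<sigma> {..<m} \<and> \<sigma> ` {..<m} = nondegenerate C 1 \<and>
        inj_on v {..<m} \<and> v ` {..<m} = simplices C 0 \<and> v m = v 0 \<and>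
        (\<forall>k < m. \<iota> k \<in> {0, 1} \<and>
           face C 1 (\<iota> k) (\<sigma> k) = v k \<and> face C 1 (1 - \<iota> k) (\<sigma> k) = v (Suc k)))"

end

theory Submission
  imports Defs
begin

text \<open>
  A simplicial map from the cone to \<open>N\<int>\<^sub>2\<close> is the same as a function \<open>a : X\<^sub>0 \<rightarrow> \<int>\<^sub>2\<close>, its values on
  the edges \<open>(c\<^sub>0, v)\<close>; on an edge of \<open>X\<close> it is the sum of the values of \<open>a\<close> at the two ends.  Hence if
  \<open>p\<close> has a map in its support, any \<open>\<phi>\<close> with \<open>p|\<^sub>C = \<delta>\<^sup>\<phi>\<close> is a coboundary and so null-homotopic.

  Conversely, let \<open>a(v)\<close> be the outcome on \<open>(c\<^sub>0, v)\<close> that has probability greater than 1/2, and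
  a value \<open>\<pi>(v)\<close> still to be chosen if both outcomes have probability 1/2.  This \<open>a\<close> can only
  violate the support condition over an edge on which \<open>p\<close> is deterministic and whose ends both
  have probabilities 1/2.  So \<open>p\<close> is not strongly contextual as soon as \<open>\<pi>\<close> is a potential for
  the deterministic edges.  If no potential exists, these edges contain an odd closed walk, and a
  shortest one is a circle on which \<open>p\<close> is a delta distribution with odd total parity.
\<close>

section \<open>Coboundaries\<close>

declare add_bit_eq_xor [simp del]

lemma bit_add_self [simp]: "a + a = (0::bit)"
  by (cases a) simp_all

text \<open>With entries in Z_2 this is the contractible total space over the nerve of Z_2. Any list
  is a simplex, so a map into it is given by a function on vertices.\<close>

definition codiscrete :: "'a list sset" where
  "codiscrete =
     \<lparr>simplices = (\<lambda>n. {xs. length xs = Suc n}),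
      face = (\<lambda>n i xs. take i xs @ drop (Suc i) xs),
      degen = (\<lambda>n j xs. take (Suc j) xs @ drop j xs)\<rparr>"

lemma simplicial_map_comp:
  assumes "simplicial_map X Y f" "simplicial_map Y Z g"
  shows "simplicial_map X Z (\<lambda>n x. g n (f n x))"
  using assms unfolding simplicial_map_def by simp

lemma simplicial_map_codiscrete_map:
  "simplicial_map codiscrete codiscrete (\<lambda>n. map f)"
  by (auto simp: simplicial_map_def codiscrete_def take_map drop_map)

text \<open>The projection of that total space onto the nerve; modulo 2 a difference is a
  sum.\<close>

definition differences :: "bit list \<Rightarrow> bit list" where
  "differences xs = map2 (+) xs (tl xs)"

lemma length_differences [simp]: "length (differences xs) = length xs - 1"
  by (simp add: differences_def)

lemma nth_differences [simp]:
  "Suc i < length xs \<Longrightarrow> differences xs ! i = xs ! i + xs ! Suc i"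
  by (simp add: differences_def nth_tl)

text \<open>Deleting an inner entry merges the two differences that contain it into their sum, where
  the entry cancels; deleting an end entry drops one difference; repeating an entry inserts a
  0.\<close>

lemma simplicial_map_differences:
  "simplicial_map codiscrete N_Z2 (\<lambda>n. differences)"
  unfolding simplicial_map_def
proof (intro conjI allI ballI impI)
  fix n and xs :: "bit list"
  assume "xs \<in> simplices codiscrete n"
  then show "differences xs \<in> simplices N_Z2 n"
    by (simp add: codiscrete_def N_Z2_def nerve_def)
next
  fix n i and xs :: "bit list"
  assume "xs \<in> simplices codiscrete (Suc n)" and i: "i \<le> Suc n"
  then have len: "length xs = Suc (Suc n)"
    by (simp add: codiscrete_def)
  have cancel: "(a + c) + (c + b) = a + b" for a b c :: bit
    by (cases a; cases b; cases c) simp_all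
  consider "i = 0" | "i = Suc n" | "0 < i" "i < Suc n"
    using i by linarith
  then show "differences (face codiscrete (Suc n) i xs) = face N_Z2 (Suc n) i (differences xs)"
  proof cases
    case 1
    then show ?thesis
      using len by (intro nth_equalityI) (simp_all add: codiscrete_def N_Z2_def nerve_def nth_tl)
  next
    case 2
    then show ?thesis
      using len by (intro nth_equalityI) (simp_all add: codiscrete_def N_Z2_def nerve_def nth_butlast)
  next
    case 3
    then obtain l where l: "i = Suc l" "l < n"
      by (cases i) auto
    let ?ys = "take i xs @ drop (Suc i) xs"
    let ?zs = "take l (differences xs) @ [differences xs ! l + differences xs ! Suc l] @ 
      drop (Suc (Suc l)) (differences xs)"
    have "differences ?ys = ?zs"
    proof (rule nth_equalityI)
      fix k assume "k < length (differences ?ys)"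
      then have k: "k < n" using len l by simp
      consider "k < l" | "k = l" | "l < k" by linarith
      then show "differences ?ys ! k = ?zs ! k"
      proof cases
        case 2
        then have "differences ?ys ! k = xs ! l + xs ! Suc (Suc l)"
          using l len by (simp only: nth_differences) (simp add: nth_append)
        moreover have "?zs ! k = (xs ! l + xs ! Suc l) + (xs ! Suc l + xs ! Suc (Suc l))"
          using 2 l len by (simp only: nth_append) simp
        ultimately show ?thesis
          by (simp only: cancel)
      qed (use k l len in \<open>simp_all add: nth_append\<close>)
    qed (use len l in simp)
    then show ?thesis
      using l by (simp add: codiscrete_def N_Z2_def nerve_def)
  qed
next
  fix n j and xs :: "bit list"
  assume "xs \<in> simplices codiscrete n" and j: "j \<le> n"
  then have len: "length xs = Suc n"
    by (simp add: codiscrete_def)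
  let ?ys = "take (Suc j) xs @ drop j xs"
  let ?zs = "take j (differences xs) @ [0] @ drop j (differences xs)"
  have "differences ?ys = ?zs"
  proof (rule nth_equalityI)
    fix k assume "k < length (differences ?ys)"
    then have k: "k < Suc n" using len j by simp
    consider "k < j" | "k = j" | "j < k" by linarith
    then show "differences ?ys ! k = ?zs ! k"
      using k j len by cases (simp_all add: nth_append Suc_diff_le)
  qed (use len j in simp)
  then show "differences (degen codiscrete n j xs) = degen N_Z2 n j (differences xs)"
    by (simp add: codiscrete_def N_Z2_def nerve_def)
qed

section \<open>Vertex lists of simplices\<close>

primrec front_vertex :: "'a sset \<Rightarrow> nat \<Rightarrow> 'a \<Rightarrow> 'a" where
  "front_vertex X 0 x = x"
| "front_vertex X (Suc n) x = front_vertex X n (face X (Suc n) (Suc n) x)"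

primrec vertex_list :: "'a sset \<Rightarrow> nat \<Rightarrow> 'a \<Rightarrow> 'a list" where
  "vertex_list X 0 x = [x]"
| "vertex_list X (Suc n) x = front_vertex X (Suc n) x # vertex_list X n (face X (Suc n) 0 x)"

lemma length_vertex_list [simp]: "length (vertex_list X n x) = Suc n"
  by (induction n arbitrary: x) simp_all

context simplicial_set
begin

text \<open>Unless \<open>i\<close> is the last index, the last face commutes with face
  \<open>i\<close>, so the induction can remove the last vertex first.\<close>

lemma front_vertex_face:
  assumes "x \<in> simplices X (Suc n)" "0 < i" "i \<le> Suc n"
  shows "front_vertex X n (face X (Suc n) i x) = front_vertex X (Suc n) x"
  using assms
proof (induction n arbitrary: x)
  case 0
  then show ?case by (simp add: le_Suc_eq)
next
  case (Suc n)
  show ?case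
  proof (cases "i = Suc (Suc n)")
    case False
    have "face X (Suc n) (Suc n) (face X (Suc (Suc n)) i x) =
        face X (Suc n) i (face X (Suc (Suc n)) (Suc (Suc n)) x)"
      using face_face[of x n i "Suc (Suc n)"] Suc.prems False by simp
    moreover have "face X (Suc (Suc n)) (Suc (Suc n)) x \<in> simplices X (Suc n)"
      using Suc.prems face_closed by simp
    ultimately show ?thesis
      using Suc.IH[of "face X (Suc (Suc n)) (Suc (Suc n)) x"] Suc.prems False by simp
  qed simp
qed

lemma front_vertex_degen:
  assumes "x \<in> simplices X n" "j \<le> n"
  shows "front_vertex X (Suc n) (degen X n j x) = front_vertex X n x"
  using assms
proof (induction n arbitrary: x)
  case 0
  then show ?case using face_degen_id[of x 0 1 0] by simp
next
  case (Suc n)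
  show ?case
  proof (cases "j = Suc n")
    case True
    then show ?thesis using Suc.prems face_degen_id[of x "Suc n" "Suc j" j] by simp
  next
    case False
    have "face X (Suc (Suc n)) (Suc (Suc n)) (degen X (Suc n) j x) =
        degen X n j (face X (Suc n) (Suc n) x)"
      using face_degen_greater[of x "Suc n" j "Suc (Suc n)"] Suc.prems False by simp
    moreover have "face X (Suc n) (Suc n) x \<in> simplices X n"
      using Suc.prems face_closed by simp
    ultimately show ?thesis
      using Suc.IH[of "face X (Suc n) (Suc n) x"] Suc.prems False by simp
  qed
qed

text \<open>Face \<open>i > 0\<close> keeps the head, by \<open>front_vertex_face\<close>, and acts
  on the tail as face \<open>i - 1\<close> by the identity d_0 d_i = d_(i-1) d_0.\<close>

lemma vertex_list_face:
  assumes "x \<in> simplices X (Suc n)" "i \<le> Suc n"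
  shows "vertex_list X n (face X (Suc n) i x) =
    take i (vertex_list X (Suc n) x) @ drop (Suc i) (vertex_list X (Suc n) x)"
  using assms
proof (induction n arbitrary: x i)
  case 0
  then show ?case by (auto simp: le_Suc_eq)
next
  case (Suc n)
  show ?case
  proof (cases i)
    case (Suc i')
    have "face X (Suc n) 0 (face X (Suc (Suc n)) i x) =
        face X (Suc n) i' (face X (Suc (Suc n)) 0 x)"
      using face_face[of x n 0 i] Suc.prems Suc by simp
    moreover have "face X (Suc (Suc n)) 0 x \<in> simplices X (Suc n)"
      using Suc.prems face_closed by simp
    moreover have "front_vertex X (Suc n) (face X (Suc (Suc n)) i x) = front_vertex X (Suc (Suc n)) x"
      using front_vertex_face[of x "Suc n" i] Suc.prems Suc by simp
    ultimately show ?thesis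
      using Suc.IH[of "face X (Suc (Suc n)) 0 x" i'] Suc.prems Suc
      by (simp del: front_vertex.simps)
  qed simp
qed

lemma vertex_list_degen:
  assumes "x \<in> simplices X n" "j \<le> n"
  shows "vertex_list X (Suc n) (degen X n j x) =
    take (Suc j) (vertex_list X n x) @ drop j (vertex_list X n x)"
  using assms
proof (induction n arbitrary: x j)
  case 0
  then show ?case using face_degen_id[of x 0 0 0] face_degen_id[of x 0 1 0] by simp
next
  case (Suc n)
  have front: "front_vertex X (Suc (Suc n)) (degen X (Suc n) j x) = front_vertex X (Suc n) x"
    using front_vertex_degen Suc.prems by blast
  show ?case
  proof (cases j)
    case 0
    then show ?thesis
      using Suc.prems face_degen_id[of x "Suc n" 0 0] front
      by (simp del: front_vertex.simps)
  next
    case (Suc j')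
    have "face X (Suc (Suc n)) 0 (degen X (Suc n) j x) = degen X n j' (face X (Suc n) 0 x)"
      using face_degen_less[of x "Suc n" 0 j] Suc.prems Suc by simp
    moreover have "face X (Suc n) 0 x \<in> simplices X n"
      using Suc.prems face_closed by simp
    ultimately show ?thesis
      using Suc.IH[of "face X (Suc n) 0 x" j'] Suc.prems Suc front
      by (simp del: front_vertex.simps add: vertex_list.simps(2)[of X "Suc n"])
  qed
qed

text \<open>With \<open>simplicial_map_codiscrete_map\<close>, this extends every function on
  vertices to a simplicial map into \<open>codiscrete\<close>.\<close>

lemma simplicial_map_vertex_list: "simplicial_map X codiscrete (vertex_list X)"
  unfolding simplicial_map_def
  by (auto simp: codiscrete_def vertex_list_face vertex_list_degen
      simp del: vertex_list.simps)

end

section \<open>Potentials and odd cycles\<close>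

text \<open>Edges may be traversed in both directions. This is a relation and not a function of the
  two ends: a vertex related to itself with parity 1 is the obstruction to a potential.\<close>

inductive connected_parity :: "'e set \<Rightarrow> ('e \<Rightarrow> 'v) \<Rightarrow> ('e \<Rightarrow> 'v) \<Rightarrow> ('e \<Rightarrow> bit) \<Rightarrow> 'v \<Rightarrow> 'v \<Rightarrow> bit \<Rightarrow> bool"
  for E s t b where
  refl: "connected_parity E s t b u u 0"
| step: "\<lbrakk>connected_parity E s t b u v c; e \<in> E; s e = v \<and> t e = w \<or> t e = v \<and> s e = w\<rbrakk> \<Longrightarrow>
    connected_parity E s t b u w (c + b e)"

text \<open>The walk to be appended is the first assumption because the induction runs over its
  steps.\<close>

lemma connected_parity_trans:
  assumes "connected_parity E s t b v w d" "connected_parity E s t b u' v c'"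
  shows "connected_parity E s t b u' w (c' + d)"
  using assms
proof (induction rule: connected_parity.induct)
  case (step u v c e w)
  then have "connected_parity E s t b u' w ((c' + c) + b e)"
    by (intro connected_parity.step) auto
  then show ?case
    by (simp only: add.assoc)
qed simp

lemma connected_parity_sym:
  assumes "connected_parity E s t b u v c"
  shows "connected_parity E s t b v u c"
  using assms
proof (induction rule: connected_parity.induct)
  case (step u v c e w)
  have "connected_parity E s t b w v (0 + b e)"
    using step.hyps by (intro connected_parity.step[OF connected_parity.refl]) auto
  then show ?case
    using connected_parity_trans[OF step.IH, of w "0 + b e"] by (simp only: add_0 add.commute)
qed (rule connected_parity.refl)

text \<open>Edges and vertices are indexed as in \<open>circle\<close>, so that a cycle found here
  serves as the witness there.\<close>

definition walk :: "'e set \<Rightarrow> ('e \<Rightarrow> 'v) \<Rightarrow> ('e \<Rightarrow> 'v) \<Rightarrow> nat \<Rightarrow> (nat \<Rightarrow> 'e) \<Rightarrow> (nat \<Rightarrow> 'v) \<Rightarrow> bool" where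
  "walk E s t m \<sigma> v \<longleftrightarrow> (\<forall>k<m. \<sigma> k \<in> E \<and>
     (s (\<sigma> k) = v k \<and> t (\<sigma> k) = v (Suc k) \<or> t (\<sigma> k) = v k \<and> s (\<sigma> k) = v (Suc k)))"

lemma connected_parity_walk:
  assumes "connected_parity E s t b u w c"
  shows "\<exists>m \<sigma> v. walk E s t m \<sigma> v \<and> v 0 = u \<and> v m = w \<and> (\<Sum>k<m. b (\<sigma> k)) = c"
  using assms
proof (induction rule: connected_parity.induct)
  case (refl u)
  show ?case
    by (intro exI[of _ 0] exI[of _ "\<lambda>_. undefined"] exI[of _ "\<lambda>_. u"]) (simp add: walk_def)
next
  case (step u x c e w)
  then obtain m \<sigma> v where w: "walk E s t m \<sigma> v" "v 0 = u" "v m = x" "(\<Sum>k<m. b (\<sigma> k)) = c"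
    by blast
  define \<sigma>' where "\<sigma>' = \<sigma>(m := e)"
  define v' where "v' = v(Suc m := w)"
  have "walk E s t (Suc m) \<sigma>' v'"
    using w step.hyps by (auto simp: walk_def less_Suc_eq \<sigma>'_def v'_def)
  moreover have "v' 0 = u" "v' (Suc m) = w" "(\<Sum>k<Suc m. b (\<sigma>' k)) = c + b e"
    using w by (simp_all add: \<sigma>'_def v'_def)
  ultimately show ?case
    by blast
qed

text \<open>The candidate potential of a vertex is the parity of some walk from a chosen representative
  of its component.\<close>

lemma potential_or_odd_closed_walk:
  fixes b :: "'e \<Rightarrow> bit"
  assumes "\<not> (\<exists>\<pi>. \<forall>e\<in>E. \<pi> (s e) + \<pi> (t e) = b e)"
  obtains m \<sigma> v where "walk E s t m \<sigma> v" "v m = v 0" "(\<Sum>k<m. b (\<sigma> k)) = 1"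
proof -
  let ?conn = "connected_parity E s t b"
  define rep where "rep u = (SOME w. \<exists>c. ?conn w u c)" for u
  define \<pi> where "\<pi> u = (SOME c. ?conn (rep u) u c)" for u
  have rep: "\<exists>c. ?conn (rep u) u c" for u
    unfolding rep_def by (rule someI[of _ u]) (auto intro: connected_parity.refl)
  have \<pi>: "?conn (rep u) u (\<pi> u)" for u
    unfolding \<pi>_def using rep[of u] by (rule someI_ex)
  obtain e where e: "e \<in> E" "\<pi> (s e) + \<pi> (t e) \<noteq> b e"
    using assms by blast
  have st: "?conn (s e) (t e) (0 + b e)"
    using e by (intro connected_parity.step[OF connected_parity.refl]) auto
  \<comment> \<open>The ends of \<open>e\<close> satisfy the same predicate, so \<open>SOME\<close>
    selects the same representative for both.\<close>
  have "(\<exists>c. ?conn w (s e) c) = (\<exists>c. ?conn w (t e) c)" for w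
    using connected_parity_trans st connected_parity_sym[OF st] by metis
  then have "rep (s e) = rep (t e)"
    by (simp add: rep_def)
  with \<pi> have "?conn (rep (t e)) (s e) (\<pi> (s e))"
    by metis
  \<comment> \<open>The closed walk runs from the representative to \<open>s e\<close>, along
    \<open>e\<close>, and back. Its parity is 1 because \<open>e\<close> violates the candidate
    potential.\<close>
  from connected_parity_trans[OF st this]
  have "?conn (rep (t e)) (rep (t e)) (\<pi> (s e) + b e + \<pi> (t e))"
    using connected_parity_trans connected_parity_sym[OF \<pi>[of "t e"]] by (metis add_0)
  moreover have "\<pi> (s e) + b e + \<pi> (t e) = 1"
    using e(2) by (cases "\<pi> (s e)"; cases "\<pi> (t e)"; cases "b e") simp_all
  ultimately have "?conn (rep (t e)) (rep (t e)) 1"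
    by (simp only:)
  from connected_parity_walk[OF this] show thesis
    using that by auto
qed

text \<open>Take a shortest odd closed walk. A repeated vertex splits it into two shorter closed
  walks, one of which is odd. With no repeated vertex, an edge can recur only in a walk of length 2
  along it and straight back, and this is even.\<close>

lemma potential_or_odd_cycle:
  fixes b :: "'e \<Rightarrow> bit"
  assumes "\<not> (\<exists>\<pi>. \<forall>e\<in>E. \<pi> (s e) + \<pi> (t e) = b e)"
  obtains m \<sigma> v where "walk E s t m \<sigma> v" "v m = v 0" "(\<Sum>k<m. b (\<sigma> k)) = 1"
    "1 \<le> m" "inj_on \<sigma> {..<m}" "inj_on v {..<m}"
proof -
  define P where "P m \<longleftrightarrow> (\<exists>\<sigma> v. walk E s t m \<sigma> v \<and> v m = v 0 \<and> (\<Sum>k<m. b (\<sigma> k)) = 1)" for m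
  have "\<exists>m. P m"
    using potential_or_odd_closed_walk[OF assms] unfolding P_def by metis
  then obtain m where m: "P m" and min: "\<And>k. k < m \<Longrightarrow> \<not> P k"
    using exists_least_iff[of P] by auto
  then obtain \<sigma> v where w: "walk E s t m \<sigma> v" "v m = v 0" "(\<Sum>k<m. b (\<sigma> k)) = 1"
    unfolding P_def by blast
  have m1: "1 \<le> m"
    using w(3) by (cases m) auto
  have closed_even: "(\<Sum>k<n. b (\<tau> k)) = 0"
    if "n < m" "walk E s t n \<tau> w" "w n = w 0" for n \<tau> w
  proof (rule ccontr)
    assume "(\<Sum>k<n. b (\<tau> k)) \<noteq> 0"
    then have "(\<Sum>k<n. b (\<tau> k)) = 1"
      by (simp only: bit_not_zero_iff)
    with min[OF that(1)] that show False
      unfolding P_def by blast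
  qed
  have no_repeat: "v i \<noteq> v j" if ij: "i < j" "j < m" for i j
  proof
    assume eq: "v i = v j"
    \<comment> \<open>The inner walk makes the \<open>d\<close> steps from \<open>i\<close> to
      \<open>j\<close>; the outer walk \<open>\<sigma>'\<close>, \<open>v'\<close> omits
      them.\<close>
    define d where "d = j - i"
    define \<sigma>' where "\<sigma>' k = (if k < i then \<sigma> k else \<sigma> (k + d))" for k
    define v' where "v' k = (if k < i then v k else v (k + d))" for k
    have inner: "walk E s t d (\<lambda>k. \<sigma> (i + k)) (\<lambda>k. v (i + k))"
      using w(1) ij by (auto simp: walk_def d_def)
    have outer: "walk E s t (m - d) \<sigma>' v'"
      unfolding walk_def
    proof (intro allI impI)
      fix k assume k: "k < m - d"
      have wk: "\<sigma> l \<in> E \<and> (s (\<sigma> l) = v l \<and> t (\<sigma> l) = v (Suc l) \<or>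
          t (\<sigma> l) = v l \<and> s (\<sigma> l) = v (Suc l))" if "l < m" for l
        using w(1) that by (simp add: walk_def)
      consider "Suc k < i" | "Suc k = i" | "i \<le> k" by linarith
      then show "\<sigma>' k \<in> E \<and> (s (\<sigma>' k) = v' k \<and> t (\<sigma>' k) = v' (Suc k) \<or>
          t (\<sigma>' k) = v' k \<and> s (\<sigma>' k) = v' (Suc k))"
      proof cases
        case 1
        then show ?thesis using wk[of k] k by (simp add: \<sigma>'_def v'_def)
      next
        case 2
        \<comment> \<open>At the seam \<open>v' i\<close> is \<open>v j\<close>, which equals
          \<open>v i\<close>.\<close>
        then have "v' (Suc k) = v (Suc k)" "v' k = v k" "\<sigma>' k = \<sigma> k"
          using ij eq by (auto simp: v'_def d_def \<sigma>'_def)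
        then show ?thesis using wk[of k] k by simp
      next
        case 3
        then show ?thesis using wk[of "k + d"] k by (simp add: \<sigma>'_def v'_def)
      qed
    qed
    have "(\<Sum>k<d. b (\<sigma> (i + k))) = 0"
      using ij eq by (intro closed_even[OF _ inner]) (auto simp: d_def)
    moreover have "(\<Sum>k<m - d. b (\<sigma>' k)) = 0"
      using ij eq w(2) by (intro closed_even[OF _ outer]) (auto simp: d_def v'_def)
    ultimately have even: "(\<Sum>k<d. b (\<sigma> (i + k))) = 0" "(\<Sum>k<m - d. b (\<sigma>' k)) = 0" .
    have "(\<Sum>k<m. b (\<sigma> k)) = (\<Sum>k<i. b (\<sigma> k)) + (\<Sum>k=i..<j. b (\<sigma> k)) + (\<Sum>k=j..<m. b (\<sigma> k))"
      using ij by (simp add: lessThan_atLeast0 sum.atLeastLessThan_concat)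
    also have "(\<Sum>k=i..<j. b (\<sigma> k)) = (\<Sum>k<d. b (\<sigma> (i + k)))"
      using ij sum.shift_bounds_nat_ivl[of "\<lambda>k. b (\<sigma> k)" 0 i d]
      by (simp add: d_def lessThan_atLeast0 add.commute)
    also have "(\<Sum>k=j..<m. b (\<sigma> k)) = (\<Sum>k=i..<m - d. b (\<sigma>' k))"
    proof -
      have "(\<Sum>k=i + d..<(m - d) + d. b (\<sigma> k)) = (\<Sum>k=i..<m - d. b (\<sigma> (k + d)))"
        by (rule sum.shift_bounds_nat_ivl)
      then show ?thesis
        using ij by (simp add: d_def \<sigma>'_def)
    qed
    also have "(\<Sum>k<i. b (\<sigma> k)) = (\<Sum>k<i. b (\<sigma>' k))"
      by (simp add: \<sigma>'_def)
    also have "(\<Sum>k<i. b (\<sigma>' k)) + (\<Sum>k<d. b (\<sigma> (i + k))) + (\<Sum>k=i..<m - d. b (\<sigma>' k)) =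
        (\<Sum>k<m - d. b (\<sigma>' k))"
    proof -
      have "i \<le> m - d" using ij by (simp add: d_def)
      then show ?thesis
        unfolding even(1) by (simp add: lessThan_atLeast0 sum.atLeastLessThan_concat)
    qed
    finally show False
      using even(2) w(3) by simp
  qed
  have inj_v: "inj_on v {..<m}"
    by (rule linorder_inj_onI) (use no_repeat in auto)
  have "\<sigma> i \<noteq> \<sigma> j" if ij: "i < j" "j < m" for i j
  proof
    assume eq: "\<sigma> i = \<sigma> j"
    \<comment> \<open>Both passages use the same two ends. In the same direction they repeat a
      vertex; the opposite direction remains.\<close>
    have "v i = v j \<or> v i = v (Suc j) \<and> v (Suc i) = v j"
      using w(1) eq ij unfolding walk_def by (metis order.strict_trans)
    then have c: "v i = v (Suc j)" "v (Suc i) = v j"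
      using no_repeat ij by auto
    have "Suc j = m"
      using no_repeat[of i "Suc j"] c ij by fastforce
    moreover have "i = 0"
      using no_repeat[of 0 i] c(1) w(2) ij \<open>Suc j = m\<close> by force
    moreover have "Suc i = j"
      using no_repeat[of "Suc i" j] c(2) ij by force
    ultimately have "m = Suc (Suc 0)" "i = 0" "j = Suc 0"
      by auto
    then have "(\<Sum>k<m. b (\<sigma> k)) = b (\<sigma> j) + b (\<sigma> j)"
      using eq by simp
    then show False
      using w(3) by simp
  qed
  then have "inj_on \<sigma> {..<m}"
    by (intro linorder_inj_onI) auto
  then show thesis
    using that w m1 inj_v by blast
qed

section \<open>Maps into the nerve and null-homotopies\<close>

lemma simplicial_map_closed:
  "\<lbrakk>simplicial_map X Y f; x \<in> simplices X n\<rbrakk> \<Longrightarrow> f n x \<in> simplices Y n"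
  by (simp add: simplicial_map_def)

lemma simplicial_map_face:
  "\<lbrakk>simplicial_map X Y f; x \<in> simplices X (Suc n); i \<le> Suc n\<rbrakk> \<Longrightarrow>
    f n (face X (Suc n) i x) = face Y (Suc n) i (f (Suc n) x)"
  by (simp add: simplicial_map_def)

lemma simplicial_map_degen:
  "\<lbrakk>simplicial_map X Y f; x \<in> simplices X n; j \<le> n\<rbrakk> \<Longrightarrow>
    f (Suc n) (degen X n j x) = degen Y n j (f n x)"
  by (simp add: simplicial_map_def)

lemma N_Z2_simplices [simp]: "gs \<in> simplices N_Z2 n \<longleftrightarrow> length gs = n"
  by (simp add: N_Z2_def nerve_def)

lemma N_Z2_degen: "degen N_Z2 n j gs = take j gs @ [0] @ drop j gs"
  by (simp add: N_Z2_def nerve_def)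

lemma N_Z2_face:
  "face N_Z2 n 0 = tl"
  "0 < n \<Longrightarrow> face N_Z2 n n = butlast"
  "\<lbrakk>0 < i; i < n\<rbrakk> \<Longrightarrow>
    face N_Z2 n i gs = take (i - 1) gs @ [gs ! (i - 1) + gs ! i] @ drop (i + 1) gs"
  by (simp_all add: N_Z2_def nerve_def fun_eq_iff)

lemma length_1_conv: "length xs = Suc 0 \<longleftrightarrow> xs = [hd xs]"
  by (cases xs) auto

lemma N_Z2_edge:
  assumes "simplicial_map Z N_Z2 \<psi>" "z \<in> simplices Z (Suc 0)"
  shows "\<psi> (Suc 0) z = [hd (\<psi> (Suc 0) z)]"
  using simplicial_map_closed[OF assms] by (simp add: length_1_conv)

text \<open>The cocycle condition: a 2-simplex \<open>[a, b]\<close> of the nerve has the edges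
  \<open>a\<close>, \<open>b\<close> and \<open>a + b\<close>. Here \<open>hd\<close> reads the bit
  off a 1-simplex.\<close>

lemma N_Z2_triangle:
  assumes "simplicial_map Z N_Z2 \<psi>" "z \<in> simplices Z (Suc (Suc 0))"
  shows "hd (\<psi> (Suc 0) (face Z (Suc (Suc 0)) (Suc 0) z)) =
    hd (\<psi> (Suc 0) (face Z (Suc (Suc 0)) (Suc (Suc 0)) z)) +
    hd (\<psi> (Suc 0) (face Z (Suc (Suc 0)) 0 z))"
proof -
  obtain a b where "\<psi> (Suc (Suc 0)) z = [a, b]"
    using simplicial_map_closed[OF assms] by (auto simp: length_Suc_conv)
  then show ?thesis
    using simplicial_map_face[OF assms] by (simp add: N_Z2_face)
qed

lemma tl_butlast_eqI:
  assumes "length xs = Suc (Suc n)" "length ys = Suc (Suc n)"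
    and "tl xs = tl ys" "butlast xs = butlast ys"
  shows "xs = ys"
proof -
  obtain a a' as where xs: "xs = a # a' # as"
    using assms(1) by (auto simp: length_Suc_conv)
  obtain b b' bs where ys: "ys = b # b' # bs"
    using assms(2) by (auto simp: length_Suc_conv)
  show ?thesis
    using assms(3,4) xs ys by simp
qed

text \<open>From dimension 2 on, a simplex of the nerve is determined by its first and last faces,
  so induction reduces equality of maps to the edges.\<close>

lemma N_Z2_map_eqI:
  assumes "simplicial_set Z" "simplicial_map Z N_Z2 \<psi>" "simplicial_map Z N_Z2 \<psi>'"
    and edges: "\<And>z. z \<in> simplices Z (Suc 0) \<Longrightarrow> hd (\<psi> (Suc 0) z) = hd (\<psi>' (Suc 0) z)"
    and "z \<in> simplices Z n"
  shows "\<psi> n z = \<psi>' n z"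
  using assms(5)
proof (induction n arbitrary: z)
  case 0
  then show ?case
    using simplicial_map_closed[OF assms(2) 0] simplicial_map_closed[OF assms(3) 0] by simp
next
  case (Suc n)
  note len = simplicial_map_closed[OF assms(2) Suc.prems] simplicial_map_closed[OF assms(3) Suc.prems]
  show ?case
  proof (cases n)
    case 0
    then show ?thesis
      using N_Z2_edge assms(2,3) edges Suc.prems by metis
  next
    case n: (Suc m)
    have "face N_Z2 (Suc n) i (\<psi> (Suc n) z) = face N_Z2 (Suc n) i (\<psi>' (Suc n) z)" if "i \<le> Suc n" for i
      using Suc.IH[OF simplicial_set.face_closed[OF assms(1) Suc.prems that]]
      by (simp add: simplicial_map_face[OF assms(2) Suc.prems that]
          simplicial_map_face[OF assms(3) Suc.prems that])
    from this[of 0] this[of "Suc n"]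
    have "tl (\<psi> (Suc n) z) = tl (\<psi>' (Suc n) z)" "butlast (\<psi> (Suc n) z) = butlast (\<psi>' (Suc n) z)"
      by (simp_all only: N_Z2_face le_refl zero_le zero_less_Suc)
    then show ?thesis
      using len n tl_butlast_eqI by (simp only: N_Z2_simplices)
  qed
qed

text \<open>The map to the nerve whose edge labels are the coboundary of the 0-cochain
  \<open>a\<close>. Factoring it through \<open>codiscrete\<close> makes it simplicial by
  construction.\<close>

definition coboundary :: "'a sset \<Rightarrow> ('a \<Rightarrow> bit) \<Rightarrow> nat \<Rightarrow> 'a \<Rightarrow> bit list" where
  "coboundary X a n x = differences (map a (vertex_list X n x))"

lemma simplicial_map_coboundary:
  assumes "simplicial_set X"
  shows "simplicial_map X N_Z2 (coboundary X a)"
  unfolding coboundary_def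
  by (intro simplicial_map_comp[OF _ simplicial_map_differences]
      simplicial_map_comp[OF _ simplicial_map_codiscrete_map]
      simplicial_set.simplicial_map_vertex_list assms)

lemma coboundary_edge:
  "coboundary X a (Suc 0) x = [a (face X (Suc 0) (Suc 0) x) + a (face X (Suc 0) 0 x)]"
  by (simp add: coboundary_def differences_def)

lemma differences_replicate: "differences (replicate (Suc n) a) = replicate n 0"
  by (intro nth_equalityI) (simp_all del: replicate_Suc)

lemma const_map_N_Z2: "const_map N_Z2 [] n x = replicate n 0"
proof -
  have "vertex_degen N_Z2 [] n = replicate n 0"
    by (induction n) (simp_all add: N_Z2_degen)
  then show ?thesis
    by (simp add: const_map_def)
qed

text \<open>The homotopy is the coboundary, on the product with the interval, of the function that is
  \<open>a\<close> at the start of the interval and 0 at its end.\<close>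

lemma coboundary_null_homotopic:
  assumes C: "simplicial_set C" and \<phi>: "simplicial_map C N_Z2 \<phi>"
    and a: "\<And>x. x \<in> simplices C (Suc 0) \<Longrightarrow>
      hd (\<phi> (Suc 0) x) = a (face C (Suc 0) (Suc 0) x) + a (face C (Suc 0) 0 x)"
  shows "null_homotopic C N_Z2 \<phi>"
proof -
  define L where "L n = (\<lambda>(x, \<theta>). map2 (\<lambda>v t. if t = (0::nat) then a v else 0) (vertex_list C n x) \<theta>)" for n
  have "simplicial_map (prod_sset C (std_simplex 1)) codiscrete L"
    using simplicial_set.vertex_list_face[OF C] simplicial_set.vertex_list_degen[OF C]
    by (auto simp: simplicial_map_def prod_sset_def std_simplex_def codiscrete_def L_def
        take_map drop_map take_zip drop_zip
        simp del: vertex_list.simps)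
  then have "simplicial_map (prod_sset C (std_simplex 1)) N_Z2 (\<lambda>n z. differences (L n z))"
    by (rule simplicial_map_comp[OF _ simplicial_map_differences])
  moreover have "differences (L n (x, replicate (Suc n) 0)) = \<phi> n x" if "x \<in> simplices C n" for n x
  proof -
    have "L n (x, replicate (Suc n) 0) = map a (vertex_list C n x)"
      unfolding L_def by (intro nth_equalityI) (simp_all del: replicate_Suc)
    then have "differences (L n (x, replicate (Suc n) 0)) = coboundary C a n x"
      by (simp only: coboundary_def)
    also have "\<dots> = \<phi> n x"
      using a by (intro N_Z2_map_eqI[OF C simplicial_map_coboundary[OF C] \<phi> _ that])
        (simp add: coboundary_edge)
    finally show ?thesis .
  qed
  moreover have "differences (L n (x, replicate (Suc n) 1)) = const_map N_Z2 [] n x" for n x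
  proof -
    have "L n (x, replicate (Suc n) 1) = replicate (Suc n) 0"
      unfolding L_def by (intro nth_equalityI) (simp_all del: replicate_Suc)
    then show ?thesis
      by (simp only: differences_replicate const_map_N_Z2)
  qed
  ultimately show ?thesis
    unfolding null_homotopic_def simplicially_homotopic_def
    by (intro bexI[of _ "[]"] exI[of _ "\<lambda>n z. differences (L n z)"]) auto
qed

text \<open>Each edge yields a square in the product with the interval; its two triangles compare the
  edge with the vertical edges over its endpoints.\<close>

lemma null_homotopic_coboundary:
  assumes C: "simplicial_set C" and "null_homotopic C N_Z2 \<phi>"
  obtains a where "\<And>x. x \<in> simplices C (Suc 0) \<Longrightarrow>
    hd (\<phi> (Suc 0) x) = a (face C (Suc 0) (Suc 0) x) + a (face C (Suc 0) 0 x)"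
proof -
  let ?Z = "prod_sset C (std_simplex 1)"
  obtain y H where y: "y \<in> simplices N_Z2 0" and H: "simplicial_map ?Z N_Z2 H"
    and H0: "\<And>n x. x \<in> simplices C n \<Longrightarrow> H n (x, replicate (Suc n) 0) = \<phi> n x"
    and H1: "\<And>n x. x \<in> simplices C n \<Longrightarrow> H n (x, replicate (Suc n) 1) = const_map N_Z2 y n x"
    using assms(2) unfolding null_homotopic_def simplicially_homotopic_def by blast
  \<comment> \<open>The value of the homotopy on the vertical edge over \<open>v\<close>.\<close>
  define a where "a v = hd (H (Suc 0) (degen C 0 0 v, [0, 1]))" for v
  have "hd (\<phi> (Suc 0) x) = a (face C (Suc 0) (Suc 0) x) + a (face C (Suc 0) 0 x)"
    if x: "x \<in> simplices C (Suc 0)" for x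
  proof -
    \<comment> \<open>The value on the diagonal of the square, an edge of both triangles.\<close>
    let ?d = "hd (H (Suc 0) (x, [0, 1]))"
    have deg: "degen C (Suc 0) j x \<in> simplices C (Suc (Suc 0))" if "j \<le> Suc 0" for j
      using simplicial_set.degen_closed[OF C x that] .
    have id: "face C (Suc (Suc 0)) i (degen C (Suc 0) j x) = x" if "i = j \<or> i = Suc j" "j \<le> Suc 0" for i j
      using simplicial_set.face_degen_id[OF C x that] .
    have 1: "face C (Suc (Suc 0)) 0 (degen C (Suc 0) (Suc 0) x) = degen C 0 0 (face C (Suc 0) 0 x)"
      using simplicial_set.face_degen_less[OF C x, of 0 "Suc 0"] by simp
    have 2: "face C (Suc (Suc 0)) (Suc (Suc 0)) (degen C (Suc 0) 0 x) =
        degen C 0 0 (face C (Suc 0) (Suc 0) x)"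
      using simplicial_set.face_degen_greater[OF C x, of 0 "Suc (Suc 0)"] by simp
    have "(degen C (Suc 0) (Suc 0) x, [0, 0, 1]) \<in> simplices ?Z (Suc (Suc 0))"
      using deg by (simp add: prod_sset_def std_simplex_def)
    from N_Z2_triangle[OF H this] have "?d = hd (\<phi> (Suc 0) x) + a (face C (Suc 0) 0 x)"
      using H0[OF x] id by (simp add: prod_sset_def std_simplex_def 1 a_def)
    \<comment> \<open>The third edge of this triangle lies at the end of the interval, where
      \<open>H\<close> is constant and contributes 0.\<close>
    moreover have "(degen C (Suc 0) 0 x, [0, 1, 1]) \<in> simplices ?Z (Suc (Suc 0))"
      using deg by (simp add: prod_sset_def std_simplex_def)
    from N_Z2_triangle[OF H this] have "?d = a (face C (Suc 0) (Suc 0) x)"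
      using H1[OF x] id y by (simp add: prod_sset_def std_simplex_def 2 a_def const_map_N_Z2)
    ultimately show ?thesis
      by (metis add.assoc add.right_neutral bit_add_self)
  qed
  then show thesis
    using that by blast
qed

section \<open>Distributions on the cone\<close>

lemma cone_simplices:
  "Apex n \<in> simplices (cone_sset X) n"
  "Base x \<in> simplices (cone_sset X) n \<longleftrightarrow> x \<in> simplices X n"
  "x \<in> simplices X l \<Longrightarrow> Mixed k x \<in> simplices (cone_sset X) (Suc (k + l))"
  by (auto simp: cone_sset_def)

lemma cone_simplices_cases:
  assumes "z \<in> simplices (cone_sset X) n"
  obtains "z = Apex n" | x where "z = Base x" "x \<in> simplices X n"
    | k l x where "z = Mixed k x" "n = Suc (k + l)" "x \<in> simplices X l"
  using assms by (auto simp: cone_sset_def)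

lemma cone_face_degen [simp]:
  "face (cone_sset X) = cone_face X" "degen (cone_sset X) = cone_degen X"
  by (simp_all add: cone_sset_def)

text \<open>Labels at the vertices of a simplex, with 0 at the cone point, so that
  \<open>differences\<close> takes the value \<open>a v\<close> on the edge from the cone point to
  \<open>v\<close>.\<close>

fun cone_labels :: "'a sset \<Rightarrow> ('a \<Rightarrow> bit) \<Rightarrow> nat \<Rightarrow> 'a cone_simplex \<Rightarrow> bit list" where
  "cone_labels X a n (Apex m) = replicate (Suc n) 0"
| "cone_labels X a n (Base x) = map a (vertex_list X n x)"
| "cone_labels X a n (Mixed k x) = replicate (Suc k) 0 @ map a (vertex_list X (n - Suc k) x)"

lemma simplicial_map_cone_labels:
  assumes X: "simplicial_set X"
  shows "simplicial_map (cone_sset X) codiscrete (cone_labels X a)"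
  unfolding simplicial_map_def
proof (intro conjI allI ballI impI)
  fix n z assume "z \<in> simplices (cone_sset X) n"
  then show "cone_labels X a n z \<in> simplices codiscrete n"
    by (cases rule: cone_simplices_cases) (simp_all add: codiscrete_def)
next
  fix n i z assume z: "z \<in> simplices (cone_sset X) (Suc n)" and i: "i \<le> Suc n"
  let ?L = "cone_labels X a (Suc n) z"
  have "cone_labels X a n (cone_face X (Suc n) i z) = take i ?L @ drop (Suc i) ?L"
    using z
  proof (cases rule: cone_simplices_cases)
    case 1
    then show ?thesis
      using i by (intro nth_equalityI) (simp_all add: nth_append del: replicate_Suc)
  next
    case (2 x)
    then show ?thesis
      using i simplicial_set.vertex_list_face[OF X] by (simp add: take_map drop_map del: vertex_list.simps)
  next
    case (3 k l x)
    show ?thesis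
    proof (cases "i \<le> k")
      case True
      have "replicate k 0 = take i (replicate (Suc k) 0) @ drop (Suc i) (replicate (Suc k) (0::bit))"
        using True by (intro nth_equalityI) (simp_all add: nth_append del: replicate_Suc)
      then show ?thesis
        \<comment> \<open>For \<open>k = 0\<close> the only copy of the cone point is deleted, which
          leaves a simplex of \<open>X\<close>.\<close>
        using 3 True by (cases k) (simp_all add: del: replicate_Suc)
    next
      case False
      then obtain j where j: "i = Suc k + j" "j \<le> l"
        using i 3 by (metis add_Suc le_add_diff_inverse nat_add_left_cancel_le not_less_eq_eq)
      show ?thesis
      \<comment> \<open>For \<open>l = 0\<close> the only vertex of the base is deleted, which
        leaves a degeneracy of the cone point.\<close>
      proof (cases l)
        case 0
        then show ?thesis using 3 j by (simp del: replicate_Suc)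
      next
        case (Suc l')
        then show ?thesis
          using 3 j simplicial_set.vertex_list_face[OF X, of x l' j]
          by (simp add: take_map drop_map del: replicate_Suc vertex_list.simps)
      qed
    qed
  qed
  then show "cone_labels X a n (face (cone_sset X) (Suc n) i z) = face codiscrete (Suc n) i ?L"
    by (simp add: codiscrete_def)
next
  fix n j z assume z: "z \<in> simplices (cone_sset X) n" and j: "j \<le> n"
  let ?L = "cone_labels X a n z"
  have "cone_labels X a (Suc n) (cone_degen X n j z) = take (Suc j) ?L @ drop j ?L"
    using z
  proof (cases rule: cone_simplices_cases)
    case 1
    then show ?thesis
      using j by (intro nth_equalityI) (simp_all add: nth_append del: replicate_Suc)
  next
    case (2 x)
    then show ?thesis
      using j simplicial_set.vertex_list_degen[OF X]
      by (simp add: take_map drop_map del: vertex_list.simps)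
  next
    case (3 k l x)
    show ?thesis
    proof (cases "j \<le> k")
      case True
      have "replicate (Suc (Suc k)) 0 =
          take (Suc j) (replicate (Suc k) 0) @ drop j (replicate (Suc k) (0::bit))"
        using True by (intro nth_equalityI) (simp_all add: nth_append del: replicate_Suc)
      then show ?thesis
        using 3 True by (simp del: replicate_Suc)
    next
      case False
      then obtain i where i: "j = Suc k + i" "i \<le> l"
        using j 3 by (metis add_Suc le_add_diff_inverse nat_add_left_cancel_le not_less_eq_eq)
      then show ?thesis
        using 3 simplicial_set.vertex_list_degen[OF X, of x l i]
        by (simp add: take_map drop_map Suc_diff_le del: replicate_Suc vertex_list.simps)
    qed
  qed
  then show "cone_labels X a (Suc n) (degen (cone_sset X) n j z) = degen codiscrete n j ?L"
    by (simp add: codiscrete_def)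
qed

section \<open>Supports of distributions under structure maps\<close>

lemma dist_sset_simps [simp]:
  "simplices (dist_sset Y) n = dists (simplices Y n)"
  "face (dist_sset Y) n i = map_pmf (face Y n i)"
  "degen (dist_sset Y) n j = map_pmf (degen Y n j)"
  by (simp_all add: dist_sset_def)

text \<open>The support of a pushforward is the image of the support, so possible outcomes are sent
  to possible outcomes.\<close>

lemma distribution_face_support:
  assumes "simplicial_distribution Z Y p" "simplicial_map Z Y \<psi>"
    and "z \<in> simplices Z (Suc n)" "i \<le> Suc n" "\<psi> (Suc n) z \<in> set_pmf (p (Suc n) z)"
  shows "\<psi> n (face Z (Suc n) i z) \<in> set_pmf (p n (face Z (Suc n) i z))"
  using assms(5) simplicial_map_face[OF assms(1,3,4)] simplicial_map_face[OF assms(2,3,4)]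
  by simp

lemma distribution_degen_support:
  assumes "simplicial_distribution Z Y p" "simplicial_map Z Y \<psi>"
    and "z \<in> simplices Z n" "j \<le> n" "\<psi> n z \<in> set_pmf (p n z)"
  shows "\<psi> (Suc n) (degen Z n j z) \<in> set_pmf (p (Suc n) (degen Z n j z))"
  using assms(5) simplicial_map_degen[OF assms(1,3,4)] simplicial_map_degen[OF assms(2,3,4)]
  by simp

lemma distribution_N_Z2_length:
  assumes "simplicial_distribution Z N_Z2 p" "z \<in> simplices Z n" "gs \<in> set_pmf (p n z)"
  shows "length gs = n"
  using simplicial_map_closed[OF assms(1,2)] assms(3) by (auto simp: dists_def)

lemma distribution_N_Z2_vertex:
  assumes "simplicial_distribution Z N_Z2 p" "z \<in> simplices Z 0"
  shows "p 0 z = return_pmf []"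
proof -
  have "set_pmf (p 0 z) \<subseteq> {[]}"
    using distribution_N_Z2_length[OF assms] by auto
  then show ?thesis
    by (simp add: set_pmf_subset_singleton)
qed

text \<open>All simplices of the cone arise from the triangles over the edges of \<open>X\<close> by faces and
  degeneracies, and these preserve membership in the support.\<close>

lemma support_dist_cone:
  assumes X: "simplicial_set X" "skeletal 1 X"
    and p: "simplicial_distribution (cone_sset X) N_Z2 p"
    and \<psi>: "simplicial_map (cone_sset X) N_Z2 \<psi>"
    and edges: "\<And>x. x \<in> simplices X (Suc 0) \<Longrightarrow>
      \<psi> (Suc (Suc 0)) (Mixed 0 x) \<in> set_pmf (p (Suc (Suc 0)) (Mixed 0 x))"
  shows "\<psi> \<in> support_dist (cone_sset X) N_Z2 p"
proof -
  note face = distribution_face_support[OF p \<psi>] and degen = distribution_degen_support[OF p \<psi>]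
  have apex: "\<psi> n (Apex n) \<in> set_pmf (p n (Apex n))" for n
  proof (induction n)
    case 0
    then show ?case
      using distribution_N_Z2_vertex[OF p cone_simplices(1)]
        simplicial_map_closed[OF \<psi> cone_simplices(1), of 0] by simp
  next
    case (Suc n)
    then show ?case
      using degen[OF cone_simplices(1), of 0 n] by simp
  qed
  have mixed0: "\<psi> (Suc n) (Mixed 0 x) \<in> set_pmf (p (Suc n) (Mixed 0 x))"
    if "x \<in> simplices X n" for n x
    using that
  proof (induction n arbitrary: x)
    case 0
    \<comment> \<open>A vertex is reached from the triangle over its degenerate edge: d_1 of that
      triangle is the pair of the cone point and the vertex.\<close>
    have "degen X 0 0 x \<in> simplices X (Suc 0)"
      using simplicial_set.degen_closed[OF X(1) 0] by simp
    with face[OF cone_simplices(3)[OF this, of 0], of "Suc 0"] edges[OF this] show ?case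
      using simplicial_set.face_degen_id[OF X(1) 0, of 0 0] by simp
  next
    case (Suc n)
    show ?case
    proof (cases "n = 0")
      case True
      then show ?thesis using edges Suc.prems by simp
    next
      case False
      then have "degenerate X (Suc n) x"
        using X(2) Suc.prems unfolding skeletal_def nondegenerate_def by fastforce
      then obtain j y where y: "j \<le> n" "y \<in> simplices X n" "x = degen X n j y"
        unfolding degenerate_def by blast
      then show ?thesis
        using degen[OF cone_simplices(3)[OF y(2), of 0], of "Suc j"] Suc.IH[OF y(2)] by simp
    qed
  qed
  have mixed: "\<psi> (Suc (k + n)) (Mixed k x) \<in> set_pmf (p (Suc (k + n)) (Mixed k x))"
    if "x \<in> simplices X n" for k n x
  proof (induction k)
    case 0
    then show ?case using mixed0[OF that] by simp
  next
    case (Suc k)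
    then show ?case
      using degen[OF cone_simplices(3)[OF that, of k], of 0] by simp
  qed
  have base: "\<psi> n (Base x) \<in> set_pmf (p n (Base x))" if "x \<in> simplices X n" for n x
    using face[OF cone_simplices(3)[OF that, of 0], of 0] mixed0[OF that] by simp
  have "\<psi> n z \<in> set_pmf (p n z)" if "z \<in> simplices (cone_sset X) n" for n z
    using that by (cases rule: cone_simplices_cases) (use apex base mixed in auto)
  then show ?thesis
    using \<psi> by (auto simp: support_dist_def set_pmf_eq)
qed

section \<open>Circles of deterministic edges\<close>

text \<open>Only degeneracies are closed off here; closure under faces follows in
  \<open>generated_face\<close> once the ends of the edges in \<open>E\<close> lie in
  \<open>V\<close>.\<close>

inductive generated :: "'a sset \<Rightarrow> 'a set \<Rightarrow> 'a set \<Rightarrow> nat \<Rightarrow> 'a \<Rightarrow> bool" for X V E where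
  vertex: "v \<in> V \<Longrightarrow> generated X V E 0 v"
| edge: "e \<in> E \<Longrightarrow> generated X V E (Suc 0) e"
| degen: "\<lbrakk>generated X V E n x; j \<le> n\<rbrakk> \<Longrightarrow> generated X V E (Suc n) (degen X n j x)"

definition generated_sset :: "'a sset \<Rightarrow> 'a set \<Rightarrow> 'a set \<Rightarrow> 'a sset" where
  "generated_sset X V E = X\<lparr>simplices := (\<lambda>n. {x. generated X V E n x})\<rparr>"

lemma generated_sset_simps [simp]:
  "simplices (generated_sset X V E) n = {x. generated X V E n x}"
  "face (generated_sset X V E) = face X"
  "degen (generated_sset X V E) = degen X"
  by (simp_all add: generated_sset_def)

lemma generated_0: "generated X V E 0 x \<longleftrightarrow> x \<in> V"
  by (auto elim: generated.cases intro: generated.vertex)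

lemma nondegenerate_generated_subset:
  "nondegenerate (generated_sset X V E) (Suc n) \<subseteq> (if n = 0 then E else {})"
proof
  fix x assume "x \<in> nondegenerate (generated_sset X V E) (Suc n)"
  then have gen: "generated X V E (Suc n) x" and nd: "\<not> degenerate (generated_sset X V E) (Suc n) x"
    by (simp_all add: nondegenerate_def)
  from gen show "x \<in> (if n = 0 then E else {})"
    by cases (use nd in \<open>auto simp: degenerate_def\<close>)
qed

locale graph_in_sset = simplicial_set X for X :: "'a sset" +
  fixes V E
  assumes vertices: "V \<subseteq> simplices X 0" and edges: "E \<subseteq> simplices X (Suc 0)"
    and endpoints: "\<And>e i. \<lbrakk>e \<in> E; i \<le> Suc 0\<rbrakk> \<Longrightarrow> face X (Suc 0) i e \<in> V"
begin

lemma generated_closed: "generated X V E n x \<Longrightarrow> x \<in> simplices X n"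
  by (induction rule: generated.induct) (use vertices edges degen_closed in auto)

text \<open>By the simplicial identities, a face of a degeneracy is the original simplex or a
  degeneracy of one of its faces.\<close>

lemma generated_face:
  "\<lbrakk>generated X V E n x; n = Suc m; i \<le> Suc m\<rbrakk> \<Longrightarrow> generated X V E m (face X n i x)"
proof (induction arbitrary: m i rule: generated.induct)
  case (edge e)
  then show ?case
    using endpoints[of e i] by (simp add: generated_0)
next
  case (degen n x j)
  note x = generated_closed[OF degen.hyps(1)]
  consider "i < j" | "i = j \<or> i = Suc j" | "Suc j < i" by linarith
  then show ?case
  proof cases
    case 1
    then obtain n' where n': "n = Suc n'"
      using degen.hyps(2) by (cases n) auto
    have "generated X V E n (degen X n' (j - 1) (face X n i x))"
      unfolding n' using degen.IH[OF n', of i] 1 degen.hyps(2) n'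
      by (intro generated.degen) auto
    then show ?thesis
      using face_degen_less[OF x 1] degen n' by simp
  next
    case 2
    then show ?thesis
      using face_degen_id[OF x] degen by simp
  next
    case 3
    then obtain n' where n': "n = Suc n'"
      using degen.prems by (cases n) auto
    have "generated X V E n (degen X n' j (face X n (i - 1) x))"
      unfolding n' using degen.IH[OF n', of "i - 1"] 3 degen.prems n'
      by (intro generated.degen) auto
    then show ?thesis
      using face_degen_greater[OF x 3] degen n' by simp
  qed
qed simp

lemma sub_sset_generated: "sub_sset (generated_sset X V E) X"
proof -
  have "simplicial_set (generated_sset X V E)"
    by unfold_locales
      (simp_all add: generated_face generated.degen generated_closed face_face degen_degen
        face_degen_less face_degen_id face_degen_greater)
  then show ?thesis
    by (auto simp: sub_sset_def dest: generated_closed)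
qed

lemma skeletal_generated: "skeletal 1 (generated_sset X V E)"
proof -
  have "nondegenerate (generated_sset X V E) n = {}" if "n > 1" for n
    using nondegenerate_generated_subset[of X V E "n - 1"] that by simp
  then show ?thesis
    by (simp add: skeletal_def)
qed

lemma nondegenerate_generated:
  assumes "E \<subseteq> nondegenerate X (Suc 0)"
  shows "nondegenerate (generated_sset X V E) (Suc 0) = E"
proof
  show "E \<subseteq> nondegenerate (generated_sset X V E) (Suc 0)"
    using assms generated_closed
    by (auto simp: nondegenerate_def degenerate_def intro: generated.edge)
qed (use nondegenerate_generated_subset[of X V E 0] in simp)

end

lemma distribution_cone_vertex:
  assumes "simplicial_distribution (cone_sset X) N_Z2 p" "x \<in> simplices X 0"
  shows "p 0 (Base x) = return_pmf []"
  using distribution_N_Z2_vertex[OF assms(1)] assms(2) by (simp add: cone_simplices)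

lemma distribution_cone_degen:
  assumes "simplicial_distribution (cone_sset X) N_Z2 p" "x \<in> simplices X n" "j \<le> n"
  shows "p (Suc n) (Base (degen X n j x)) = map_pmf (degen N_Z2 n j) (p n (Base x))"
  using simplicial_map_degen[OF assms(1), of "Base x" n j] assms by (simp add: cone_simplices)

lemma distribution_cone_face:
  assumes "simplicial_distribution (cone_sset X) N_Z2 p" "x \<in> simplices X (Suc n)" "i \<le> Suc n"
  shows "p n (Base (face X (Suc n) i x)) = map_pmf (face N_Z2 (Suc n) i) (p (Suc n) (Base x))"
  using simplicial_map_face[OF assms(1), of "Base x" n i] assms by (simp add: cone_simplices)

text \<open>The outcome of \<open>p\<close> at a simplex where it is a delta distribution, and junk elsewhere.\<close>

definition outcome :: "(nat \<Rightarrow> 'a cone_simplex \<Rightarrow> 'b pmf) \<Rightarrow> nat \<Rightarrow> 'a \<Rightarrow> 'b" where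
  "outcome p n x = (SOME g. p n (Base x) = return_pmf g)"

lemma outcome_eqI: "p n (Base x) = return_pmf g \<Longrightarrow> outcome p n x = g"
  by (simp add: outcome_def)

text \<open>The cycle generates the circle. There \<open>p\<close> is a delta distribution on
  vertices and edges, hence on all degeneracies, and its outcomes form the map. A null-homotopy
  would write the edge labels as a coboundary, whose sum around the cycle is 0.\<close>

lemma odd_cycle_imp_circle:
  fixes X :: "'a sset"
  assumes X: "simplicial_set X"
    and p: "simplicial_distribution (cone_sset X) N_Z2 p"
    and E: "E = {x \<in> nondegenerate X (Suc 0). \<exists>g. p (Suc 0) (Base x) = return_pmf g}"
    and walk: "walk E (face X (Suc 0) (Suc 0)) (face X (Suc 0) 0) m \<sigma> v" "v m = v 0" "1 \<le> m"
    and inj: "inj_on \<sigma> {..<m}" "inj_on v {..<m}"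
    and odd: "(\<Sum>k<m. hd (outcome p (Suc 0) (\<sigma> k))) = 1"
  shows "\<exists>C \<phi>. sub_sset C X \<and> circle C \<and>
       simplicial_map C N_Z2 \<phi> \<and> \<not> null_homotopic C N_Z2 \<phi> \<and>
       (\<forall>n. \<forall>x \<in> simplices C n. p n (Base x) = delta \<phi> n x)"
proof -
  let ?s = "face X (Suc 0) (Suc 0)" and ?t = "face X (Suc 0) 0"
  define C where "C = generated_sset X (v ` {..<m}) (\<sigma> ` {..<m})"
  have ends: "?s (\<sigma> k) = v k \<and> ?t (\<sigma> k) = v (Suc k) \<or> ?t (\<sigma> k) = v k \<and> ?s (\<sigma> k) = v (Suc k)"
    if "k < m" for k
    using walk(1) that by (simp add: walk_def)
  have \<sigma>E: "\<sigma> ` {..<m} \<subseteq> E"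
    using walk(1) by (auto simp: walk_def)
  have \<sigma>X: "\<sigma> k \<in> simplices X (Suc 0)" if "k < m" for k
    using \<sigma>E that by (auto simp: E nondegenerate_def)
  have v_Suc: "v (Suc k) \<in> v ` {..<m}" if "k < m" for k
    using that walk(2,3) by (cases "Suc k = m") auto
  interpret graph_in_sset X "v ` {..<m}" "\<sigma> ` {..<m}"
  proof (intro graph_in_sset.intro graph_in_sset_axioms.intro X)
    have "v k \<in> simplices X 0" if "k < m" for k
      using ends[OF that] simplicial_set.face_closed[OF X \<sigma>X[OF that]] by (metis le_refl zero_le)
    then show "v ` {..<m} \<subseteq> simplices X 0"
      by auto
    show "\<sigma> ` {..<m} \<subseteq> simplices X (Suc 0)"
      using \<sigma>X by auto
    show "face X (Suc 0) i e \<in> v ` {..<m}" if "e \<in> \<sigma> ` {..<m}" "i \<le> Suc 0" for e i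
      using that ends v_Suc by (auto simp: le_Suc_eq) (metis imageI lessThan_iff)+
  qed
  have sub: "sub_sset C X"
    unfolding C_def by (rule sub_sset_generated)
  then have C: "simplicial_set C"
    by (simp add: sub_sset_def)
  have "circle C"
  proof -
    \<comment> \<open>The index of the face of \<open>\<sigma> k\<close> at which the walk enters:
      d_1 is the source of an edge, d_0 its target.\<close>
    define \<iota> where "\<iota> k = (if ?s (\<sigma> k) = v k \<and> ?t (\<sigma> k) = v (Suc k) then 1 else 0 :: nat)" for k
    have "\<iota> k \<in> {0, 1} \<and> face C 1 (\<iota> k) (\<sigma> k) = v k \<and> face C 1 (1 - \<iota> k) (\<sigma> k) = v (Suc k)"
      if "k < m" for k
      using ends[OF that] by (auto simp: \<iota>_def C_def)
    moreover have "\<sigma> ` {..<m} = nondegenerate C 1"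
      using nondegenerate_generated \<sigma>E by (auto simp: C_def E)
    moreover have "v ` {..<m} = simplices C 0"
      by (auto simp: C_def generated_0)
    moreover have "skeletal 1 C"
      unfolding C_def by (rule skeletal_generated)
    ultimately show ?thesis
      unfolding circle_def using C walk(2,3) inj by blast
  qed
  have delta: "p n (Base x) = return_pmf (outcome p n x)" if "x \<in> simplices C n" for n x
  proof -
    have "generated X (v ` {..<m}) (\<sigma> ` {..<m}) n x"
      using that by (simp add: C_def)
    then have "\<exists>g. p n (Base x) = return_pmf g"
    proof (induction rule: generated.induct)
      case (vertex x)
      then show ?case
        using distribution_cone_vertex[OF p] vertices by blast
    next
      case (edge x)
      then show ?case
        using \<sigma>E by (auto simp: E)
    next
      case (degen n x j)
      then show ?case
        using distribution_cone_degen[OF p generated_closed[OF degen.hyps(1)]] by auto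
    qed
    then show ?thesis
      by (auto simp: outcome_eqI)
  qed
  have CX: "x \<in> simplices X n" if "x \<in> simplices C n" for n x
    using sub that by (auto simp: sub_sset_def)
  have \<phi>: "simplicial_map C N_Z2 (outcome p)"
    unfolding simplicial_map_def
  proof (intro conjI allI ballI impI)
    fix n x assume x: "x \<in> simplices C n"
    have "Base x \<in> simplices (cone_sset X) n"
      using CX[OF x] by (simp add: cone_simplices)
    then show "outcome p n x \<in> simplices N_Z2 n"
      using distribution_N_Z2_length[OF p, of "Base x" n] delta[OF x] by simp
  next
    fix n x i assume "x \<in> simplices C (Suc n)" and "i \<le> Suc n"
    then show "outcome p n (face C (Suc n) i x) = face N_Z2 (Suc n) i (outcome p (Suc n) x)"
      using distribution_cone_face[OF p CX] delta by (intro outcome_eqI) (simp add: C_def)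
  next
    fix n x j assume "x \<in> simplices C n" and "j \<le> n"
    then show "outcome p (Suc n) (degen C n j x) = degen N_Z2 n j (outcome p n x)"
      using distribution_cone_degen[OF p CX] delta by (intro outcome_eqI) (simp add: C_def)
  qed
  have "\<not> null_homotopic C N_Z2 (outcome p)"
  proof
    assume "null_homotopic C N_Z2 (outcome p)"
    then obtain a where a: "\<And>x. x \<in> simplices C (Suc 0) \<Longrightarrow>
        hd (outcome p (Suc 0) x) = a (face C (Suc 0) (Suc 0) x) + a (face C (Suc 0) 0 x)"
      using null_homotopic_coboundary[OF C] by metis
    have edge: "hd (outcome p (Suc 0) (\<sigma> k)) = a (v k) + a (v (Suc k))" if "k < m" for k
    proof -
      have "hd (outcome p (Suc 0) (\<sigma> k)) = a (?s (\<sigma> k)) + a (?t (\<sigma> k))"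
        using a[of "\<sigma> k"] that by (simp add: C_def generated.edge)
      then show ?thesis
        using ends[OF that] by (auto simp: add.commute)
    qed
    \<comment> \<open>The sum telescopes modulo 2.\<close>
    have "(\<Sum>k<n. a (v k) + a (v (Suc k))) = a (v 0) + a (v n)" for n
    proof (induction n)
      case (Suc n)
      then show ?case
        by (cases "a (v 0)"; cases "a (v n)"; cases "a (v (Suc n))") simp_all
    qed simp
    then have "(\<Sum>k<m. hd (outcome p (Suc 0) (\<sigma> k))) = a (v 0) + a (v m)"
      by (simp add: edge)
    then show False
      using odd walk(2) by simp
  qed
  with sub \<open>circle C\<close> \<phi> delta show ?thesis
    unfolding delta_def by blast
qed

section \<open>Choosing likely outcomes\<close>

lemma pmf_map_pair:
  assumes "set_pmf P \<subseteq> S" "{g \<in> S. f g = y} = {g, h}" "g \<noteq> h"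
  shows "pmf (map_pmf f P) y = pmf P g + pmf P h"
proof -
  have "pmf (map_pmf f P) y = measure P (f -` {y} \<inter> set_pmf P)"
    by (simp add: pmf_map measure_Int_set_pmf)
  also have "f -` {y} \<inter> set_pmf P = {g, h} \<inter> set_pmf P"
    using assms(1,2) by auto
  also have "measure P \<dots> = pmf P g + pmf P h"
    using assms(3) by (simp add: measure_Int_set_pmf measure_measure_pmf_finite)
  finally show ?thesis .
qed

lemma bit_lists_2: "{gs :: bit list. length gs = Suc (Suc 0)} = {[0, 0], [0, 1], [1, 0], [1, 1]}"
proof -
  have "gs \<in> {[0, 0], [0, 1], [1, 0], [1, 1]}" if gs: "length gs = Suc (Suc 0)" for gs :: "bit list"
  proof -
    obtain a b where "gs = [a, b]"
      using gs by (auto simp: length_Suc_conv)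
    then show ?thesis
      by (cases a; cases b) auto
  qed
  then show ?thesis by auto
qed

text \<open>Two disjoint events of probability at least 1/2 both have probability exactly 1/2 and
  together are almost sure; here this means that exactly one endpoint takes its given value, which
  makes the outcome on the edge deterministic.\<close>

lemma majority_outcome:
  fixes P :: "bit list pmf"
  assumes P: "set_pmf P \<subseteq> {gs. length gs = Suc (Suc 0)}"
    and src: "pmf (map_pmf butlast P) [a] \<ge> 1 / 2"
    and tgt: "pmf (map_pmf (\<lambda>gs. [gs ! 0 + gs ! 1]) P) [b] \<ge> 1 / 2"
    and zero: "[a, a + b] \<notin> set_pmf P"
  shows "map_pmf tl P = return_pmf [a + b + 1] \<and>
    pmf (map_pmf butlast P) [a] = 1 / 2 \<and>
    pmf (map_pmf (\<lambda>gs. [gs ! 0 + gs ! 1]) P) [b] = 1 / 2"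
proof -
  note S = P[unfolded bit_lists_2]
  let ?S = "{[0, 0], [0, 1], [1, 0], [1, 1]} :: bit list set"
  \<comment> \<open>\<open>[a, a + b]\<close> is the only outcome with both required edge values, so
    it lies in both fibres; having probability 0, it makes the two events almost surely
    disjoint.\<close>
  have 1: "pmf (map_pmf butlast P) [a] = pmf P [a, a + b] + pmf P [a, a + b + 1]"
    by (rule pmf_map_pair[OF S]) (cases a; cases b; auto)+
  have 2: "pmf (map_pmf (\<lambda>gs. [gs ! 0 + gs ! 1]) P) [b] =
      pmf P [a, a + b] + pmf P [a + 1, a + b + 1]"
    by (rule pmf_map_pair[OF S]) (cases a; cases b; auto)+
  have "(\<Sum>gs\<in>?S. pmf P gs) = 1"
    using S by (intro sum_pmf_eq_1) auto
  then have total: "pmf P [a, a + b] + pmf P [a, a + b + 1] +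
      pmf P [a + 1, a + b] + pmf P [a + 1, a + b + 1] = 1"
    by (cases a; cases b) simp_all
  have z: "pmf P [a, a + b] = 0"
    using zero by (simp add: set_pmf_iff)
  with 1 2 src tgt total pmf_nonneg[of P "[a + 1, a + b]"]
  have half: "pmf P [a, a + b + 1] = 1 / 2" "pmf P [a + 1, a + b + 1] = 1 / 2"
    and z': "pmf P [a + 1, a + b] = 0"
    by linarith+
  \<comment> \<open>The two lists that remain possible share the second entry
    \<open>a + b + 1\<close>.\<close>
  have "tl gs = [a + b + 1]" if "gs \<in> set_pmf P" for gs
  proof -
    have "gs \<in> ?S" "gs \<noteq> [a, a + b]" "gs \<noteq> [a + 1, a + b]"
      using that S z z' by (auto simp: set_pmf_iff)
    then show ?thesis
      by (cases a; cases b) auto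
  qed
  then have "set_pmf (map_pmf tl P) \<subseteq> {[a + b + 1]}"
    by auto
  then show ?thesis
    using 1 2 z half by (simp only: set_pmf_subset_singleton add_0 refl simp_thms)
qed

text \<open>Let \<open>a\<close> follow the likelier outcome and let \<open>\<pi>\<close> break
  ties. By \<open>majority_outcome\<close>, a triangle where the resulting map is impossible has
  ties at both ends and a deterministic edge whose value differs from that given by
  \<open>\<pi>\<close>.\<close>

lemma potential_imp_not_contextual:
  fixes X :: "'a sset" and \<pi> :: "'a \<Rightarrow> bit"
  assumes X: "simplicial_set X" "skeletal 1 X"
    and p: "simplicial_distribution (cone_sset X) N_Z2 p"
    and \<pi>: "\<And>x b. \<lbrakk>x \<in> nondegenerate X (Suc 0); p (Suc 0) (Base x) = return_pmf [b]\<rbrakk> \<Longrightarrow>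
      \<pi> (face X (Suc 0) (Suc 0) x) + \<pi> (face X (Suc 0) 0 x) = b"
  shows "\<not> strongly_contextual (cone_sset X) N_Z2 p"
proof -
  \<comment> \<open>A degenerate edge is a loop with outcome 0, so every \<open>\<pi>\<close>
    satisfies the condition there.\<close>
  have \<pi>_edge: "\<pi> (face X (Suc 0) (Suc 0) x) + \<pi> (face X (Suc 0) 0 x) = b"
    if x: "x \<in> simplices X (Suc 0)" and b: "p (Suc 0) (Base x) = return_pmf [b]" for x b
  proof (cases "degenerate X (Suc 0) x")
    case True
    then obtain y where y: "y \<in> simplices X 0" "x = degen X 0 0 y"
      by (auto simp: degenerate_def)
    have "return_pmf [b] = return_pmf [0]"
      using distribution_cone_degen[OF p y(1), of 0] distribution_cone_vertex[OF p y(1)] b y(2)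
      by (simp add: N_Z2_degen)
    then show ?thesis
      using simplicial_set.face_degen_id[OF X(1) y(1), of _ 0] y(2) by simp
  next
    case False
    then show ?thesis
      using \<pi> x b by (simp add: nondegenerate_def)
  qed
  define q where "q v b = pmf (p (Suc 0) (Mixed 0 v)) [b]" for v b
  have q: "q v 0 + q v 1 = 1" if "v \<in> simplices X 0" for v
  proof -
    have "set_pmf (p (Suc 0) (Mixed 0 v)) \<subseteq> {[0], [1]}"
    proof
      fix gs assume "gs \<in> set_pmf (p (Suc 0) (Mixed 0 v))"
      then have "length gs = Suc 0"
        using distribution_N_Z2_length[OF p] cone_simplices(3)[OF that, of 0] by simp
      then show "gs \<in> {[0], [1]}"
        by (cases "hd gs") (auto simp: length_Suc_conv)
    qed
    then have "(\<Sum>gs\<in>{[0], [1]}. pmf (p (Suc 0) (Mixed 0 v)) gs) = 1"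
      by (intro sum_pmf_eq_1) auto
    then show ?thesis
      by (simp add: q_def)
  qed
  define a where "a v = (if q v 1 > 1 / 2 then 1 else if q v 1 < 1 / 2 then 0 else \<pi> v)" for v
  have a_ge: "q v (a v) \<ge> 1 / 2" if "v \<in> simplices X 0" for v
    using q[OF that] by (cases "\<pi> v") (auto simp: a_def)
  have a_eq: "a v = \<pi> v" if "v \<in> simplices X 0" "q v (a v) = 1 / 2" for v
    using q[OF that(1)] that(2) by (auto simp: a_def split: if_splits)
  define \<psi> where "\<psi> n z = differences (cone_labels X a n z)" for n z
  have \<psi>: "simplicial_map (cone_sset X) N_Z2 \<psi>"
    unfolding \<psi>_def
    by (intro simplicial_map_comp[OF simplicial_map_cone_labels[OF X(1)] simplicial_map_differences])
  have "\<psi> (Suc (Suc 0)) (Mixed 0 x) \<in> set_pmf (p (Suc (Suc 0)) (Mixed 0 x))"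
    if x: "x \<in> simplices X (Suc 0)" for x
  proof (rule ccontr)
    let ?P = "p (Suc (Suc 0)) (Mixed 0 x)"
    let ?s = "face X (Suc 0) (Suc 0) x" and ?t = "face X (Suc 0) 0 x"
    have st: "?s \<in> simplices X 0" "?t \<in> simplices X 0"
      using simplicial_set.face_closed[OF X(1) x] by auto
    have mixed: "Mixed 0 x \<in> simplices (cone_sset X) (Suc (Suc 0))"
      using cone_simplices(3)[OF x, of 0] by simp
    \<comment> \<open>The faces d_1, d_2 and d_0 of the triangle give the marginals at the target,
      at the source and on the edge \<open>x\<close> itself.\<close>
    have "face N_Z2 (Suc (Suc 0)) (Suc 0) gs = [gs ! 0 + gs ! 1]" if "gs \<in> set_pmf ?P" for gs
      using distribution_N_Z2_length[OF p mixed that] by (auto simp: N_Z2_face length_Suc_conv)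
    then have tgt: "p (Suc 0) (Mixed 0 ?t) = map_pmf (\<lambda>gs. [gs ! 0 + gs ! 1]) ?P"
      using simplicial_map_face[OF p mixed, of "Suc 0"] by (simp cong: map_pmf_cong)
    have src: "p (Suc 0) (Mixed 0 ?s) = map_pmf butlast ?P"
      using simplicial_map_face[OF p mixed, of "Suc (Suc 0)"]
      by (simp add: N_Z2_face(2))
    have base: "p (Suc 0) (Base x) = map_pmf tl ?P"
      using simplicial_map_face[OF p mixed, of 0] by (simp add: N_Z2_face)
    assume "\<psi> (Suc (Suc 0)) (Mixed 0 x) \<notin> set_pmf ?P"
    moreover have "\<psi> (Suc (Suc 0)) (Mixed 0 x) = [a ?s, a ?s + a ?t]"
      by (simp add: \<psi>_def differences_def)
    ultimately have "p (Suc 0) (Base x) = return_pmf [a ?s + a ?t + 1]"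
      "q ?s (a ?s) = 1 / 2" "q ?t (a ?t) = 1 / 2"
      using majority_outcome[of ?P "a ?s" "a ?t"] distribution_N_Z2_length[OF p mixed]
        a_ge[OF st(1)] a_ge[OF st(2)]
      by (auto simp: q_def tgt src base)
    then have "\<pi> ?s + \<pi> ?t = \<pi> ?s + \<pi> ?t + 1"
      using \<pi>_edge[OF x] a_eq[OF st(1)] a_eq[OF st(2)] by metis
    then show False
      by simp
  qed
  then have "\<psi> \<in> support_dist (cone_sset X) N_Z2 p"
    by (rule support_dist_cone[OF X p \<psi>])
  then show ?thesis
    by (auto simp: strongly_contextual_def)
qed

text \<open>A delta distribution has one possible outcome, so \<open>\<psi>\<close> agrees with
  \<open>\<phi>\<close> on \<open>C\<close>. The cocycle condition on the triangles over the edges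
  of \<open>C\<close> then exhibits \<open>\<phi>\<close> as a coboundary.\<close>

lemma support_imp_null_homotopic:
  fixes X :: "'a sset"
  assumes C: "sub_sset C X" and \<phi>: "simplicial_map C N_Z2 \<phi>"
    and delta: "\<And>n x. x \<in> simplices C n \<Longrightarrow> p n (Base x) = delta \<phi> n x"
    and \<psi>: "\<psi> \<in> support_dist (cone_sset X) N_Z2 p"
  shows "null_homotopic C N_Z2 \<phi>"
proof (rule coboundary_null_homotopic[OF _ \<phi>])
  show "simplicial_set C"
    using C by (simp add: sub_sset_def)
  define a where "a v = hd (\<psi> (Suc 0) (Mixed 0 v))" for v
  fix x assume x: "x \<in> simplices C (Suc 0)"
  then have xX: "x \<in> simplices X (Suc 0)"
    and face: "\<And>i. i \<le> Suc 0 \<Longrightarrow> face C (Suc 0) i x = face X (Suc 0) i x"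
    using C by (auto simp: sub_sset_def)
  have "pmf (p (Suc 0) (Base x)) (\<psi> (Suc 0) (Base x)) \<noteq> 0"
    using \<psi> xX by (simp add: support_dist_def cone_simplices)
  then have "\<psi> (Suc 0) (Base x) = \<phi> (Suc 0) x"
    using delta[OF x] by (auto simp: delta_def indicator_def split: if_splits)
  moreover have "simplicial_map (cone_sset X) N_Z2 \<psi>"
    using \<psi> by (simp add: support_dist_def)
  from N_Z2_triangle[OF this, of "Mixed 0 x"] cone_simplices(3)[OF xX, of 0]
  have "a (face X (Suc 0) 0 x) = a (face X (Suc 0) (Suc 0) x) + hd (\<psi> (Suc 0) (Base x))"
    by (simp add: a_def)
  ultimately show "hd (\<phi> (Suc 0) x) = a (face C (Suc 0) (Suc 0) x) + a (face C (Suc 0) 0 x)"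
    by (simp add: face add.assoc[symmetric])
qed

theorem corollary4p31:
  fixes X :: "'a sset"
    and p :: "nat \<Rightarrow> 'a cone_simplex \<Rightarrow> bit list pmf"
  assumes "simplicial_set X"
    and "skeletal 1 X"
    and "finitely_many_nondegenerate X"
    and "simplicial_distribution (cone_sset X) N_Z2 p"
  shows "strongly_contextual (cone_sset X) N_Z2 p \<longleftrightarrow>
    (\<exists>C \<phi>. sub_sset C X \<and> circle C \<and>
       simplicial_map C N_Z2 \<phi> \<and> \<not> null_homotopic C N_Z2 \<phi> \<and>
       (\<forall>n. \<forall>x \<in> simplices C n. p n (Base x) = delta \<phi> n x))"
    (is "_ \<longleftrightarrow> ?circle")
proof
  assume contextual: "strongly_contextual (cone_sset X) N_Z2 p"
  \<comment> \<open>The deterministic non-degenerate edges, labelled below by their outcomes.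
    Lacking a potential, they contain an odd cycle.\<close>
  define E where "E = {x \<in> nondegenerate X (Suc 0). \<exists>g. p (Suc 0) (Base x) = return_pmf g}"
  have "\<nexists>\<pi>. \<forall>e\<in>E. \<pi> (face X (Suc 0) (Suc 0) e) + \<pi> (face X (Suc 0) 0 e) = hd (outcome p (Suc 0) e)"
  proof
    assume "\<exists>\<pi>. \<forall>e\<in>E. \<pi> (face X (Suc 0) (Suc 0) e) + \<pi> (face X (Suc 0) 0 e) =
      hd (outcome p (Suc 0) e)"
    then obtain \<pi> where "\<forall>e\<in>E. \<pi> (face X (Suc 0) (Suc 0) e) + \<pi> (face X (Suc 0) 0 e) =
      hd (outcome p (Suc 0) e)" ..
    then have "\<not> strongly_contextual (cone_sset X) N_Z2 p"
      by (intro potential_imp_not_contextual[OF assms(1,2,4), of \<pi>]) (auto simp: E_def outcome_eqI)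
    with contextual show False by simp
  qed
  then obtain m \<sigma> v where "walk E (face X (Suc 0) (Suc 0)) (face X (Suc 0) 0) m \<sigma> v"
    "v m = v 0" "(\<Sum>k<m. hd (outcome p (Suc 0) (\<sigma> k))) = 1" "1 \<le> m"
    "inj_on \<sigma> {..<m}" "inj_on v {..<m}"
    by (rule potential_or_odd_cycle)
  then show ?circle
    using odd_cycle_imp_circle[OF assms(1,4) E_def] by blast
next
  assume ?circle
  then show "strongly_contextual (cone_sset X) N_Z2 p"
    unfolding strongly_contextual_def using support_imp_null_homotopic by blast
qed

end
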